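(* Let $f\colon \mathbb{S}^{n\times n}\to\mathbb{R}$ be twice continuously differentiable, let $Y\in\mathrm{St}(d,p)^m$ and $X=YY^\top\in\mathcal{C}$. \begin{itemize} \item If $f$ is linear and $Y$ is a critical point of $(\mathrm{RP}_p)$, then $f$ is constant over $\mathcal{F}_X$. If furthermore $Y$ is a second-order critical point of $(\mathrm{RP}_p)$ and $p>\lfloor p^*\rfloor$, then either $X$ is globally optimal for $(\mathrm{P})$, or $Y$ has full rank $p$ and the face $\mathcal{F}_X$ has positive dimension and is suboptimal (the constant value of $f$ on $\mathcal{F}_X$ is strictly larger than the optimal value of $(\mathrm{P})$). \item If $f$ is strongly concave and $Y$ is a second-order critical point of $(\mathrm{RP}_p)$, then $X$ is an extreme point of $\mathcal{C}$. In particular, all second-order critical points of $(\mathrm{RP}_p)$ have rank at most $\lfloor p^*\rfloor$, and if $p>\lfloor p^*\rfloor$ then $X$ is a KKT point of $(\mathrm{P})$. \item If $f$ is convex (resp., strictly convex) and $Y$ is a critical point of $(\mathrm{RP}_p)$, then $X$ is an optimizer (resp., the unique optimizer) of $\min_{\tilde X\in\mathcal{F}_X} f(\tilde X)$. \end{itemize}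
   Context: Integers satisfy $m\ge 1$, $1\le d\le p\le n=md$. $\mathbb{S}^{k\times k}$ is the space of real symmetric $k\times k$ matrices. Matrices $M\in\mathbb{R}^{n\times n}$ are viewed as $m\times m$ block matrices with blocks $M_{ij}\in\mathbb{R}^{d\times d}$; $Y\in\mathbb{R}^{n\times p}$ is viewed as a stack of slices $Y_1,\dots,Y_m\in\mathbb{R}^{d\times p}$. Inner product: $\langle A,B\rangle=\operatorname{trace}(A^\top B)$. $\nabla f(X)\in\mathbb{S}^{n\times n}$ and $\nabla^2 f(X)$ are the Euclidean gradient and Hessian operator of $f$ on $\mathbb{S}^{n\times n}$. Define $\mathrm{St}(d,p)^m=\{Y\in\mathbb{R}^{n\times p}: Y_iY_i^\top=I_d,\ i=1,\dots,m\}$ and $\mathcal{C}=\{X\in\mathbb{S}^{n\times n}: X\succeq 0,\ X_{ii}=I_d,\ i=1,\dots,m\}$. Problem $(\mathrm{P})$: minimize $f(X)$ over $X\in\mathcal{C}$. Problem $(\mathrm{RP}_p)$: minimize $g(Y)=f(YY^\top)$ over $Y\in\mathrm{St}(d,p)^m$. $\operatorname{symblockdiag}(M)$ is the matrix with diagonal blocks $(M_{ii}+M_{ii}^\top)/2$ and all other blocks zero. The tangent space is $\mathrm{T}_Y\mathrm{St}(d,p)^m=\{\dot Y\in\mathbb{R}^{n\times p}:\operatorname{symblockdiag}(\dot YY^\top+Y\dot Y^\top)=0\}$. With $X=YY^\top$, $Y\in\mathrm{St}(d,p)^m$ is a critical point of $(\mathrm{RP}_p)$ if the Riemannian gradient of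 $g$ vanishes, i.e. $(\nabla f(X)-\operatorname{symblockdiag}(\nabla f(X)X))Y=0$. It is a second-order critical point if moreover the Riemannian Hessian is positive semidefinite, i.e. $\langle\dot Y,\nabla^2 g(Y)[\dot Y]-\operatorname{symblockdiag}(\nabla g(Y)Y^\top)\dot Y\rangle\ge 0$ for all $\dot Y\in\mathrm{T}_Y\mathrm{St}(d,p)^m$, where $\nabla g(Y)=2\nabla f(X)Y$ and $\nabla^2g(Y)[\dot Y]=2(\nabla^2f(X)[\dot X]Y+\nabla f(X)\dot Y)$ with $\dot X=\dot YY^\top+Y\dot Y^\top$. $X\in\mathcal{C}$ is a KKT point of $(\mathrm{P})$ if there exist $\hat S\in\mathbb{S}^{n\times n}$ and a symmetric block-diagonal (with $d\times d$ blocks) $\hat\Lambda\in\mathbb{S}^{n\times n}$ such that $\hat SX=0$, $\hat S=\nabla f(X)+\hat\Lambda$ and $\hat S\succeq 0$. A face of $\mathcal{C}$ is a convex subset $\mathcal{F}\subseteq\mathcal{C}$ such that every closed line segment in $\mathcal{C}$ with a relative interior point in $\mathcal{F}$ has both endpoints in $\mathcal{F}$. For $X\in\mathcal{C}$, $\mathcal{F}_X$ is the unique face of $\mathcal{C}$ containing $X$ in its relative interior. Explicitly, if $X=ZZ^\top$ with $Z\in\mathbb{R}^{n\times r}$, $r=\operatorname{rank}(X)$, then $\mathcal{F}_X=\{Z(I_r+A)Z^\top: A\in\mathbb{S}^{r\times r},\ Z_iAZ_i^\top=0\ (i=1,\dots,m),\ I_r+A\succeq 0\}$, and $\dim\mathcal{F}_X=\dim\{A\in\mathbb{S}^{r\times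 r}: Z_iAZ_i^\top=0,\ i=1,\dots,m\}$. $X$ is an extreme point of $\mathcal{C}$ if and only if $\dim\mathcal{F}_X=0$. $p^*=\dfrac{\sqrt{1+4md(d+1)}-1}{2}$. *)

theory Defs
  imports "HOL-Analysis.Analysis"
begin

(* The row index type 'm \<times> 'd encodes n = m d: the index (i, a) is row a of block i.
   On real^'a^'b the library inner product (\<bullet>) is trace (A^T B), so norm is the Frobenius norm. *)

lemma inner_eq_trace: "A \<bullet> B = trace (transpose A ** B)" for A B :: "real^'p^'q"
proof -
  have "A \<bullet> B = (\<Sum>i\<in>UNIV. \<Sum>j\<in>UNIV. A $ i $ j * B $ i $ j)"
    by (simp add: inner_vec_def)
  also have "\<dots> = (\<Sum>j\<in>UNIV. \<Sum>i\<in>UNIV. A $ i $ j * B $ i $ j)"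
    by (rule sum.swap)
  finally show ?thesis
    by (simp add: trace_def matrix_matrix_mult_def transpose_def)
qed

definition syms :: "(real^'k^'k) set" where
  "syms = {M. transpose M = M}"

definition psd :: "real^'k^'k \<Rightarrow> bool" where
  "psd M \<longleftrightarrow> M \<in> syms \<and> (\<forall>x. 0 \<le> x \<bullet> (M *v x))"

definition block :: "real^('m::finite \<times> 'd::finite)^('m \<times> 'd) \<Rightarrow> 'm \<Rightarrow> 'm \<Rightarrow> real^'d^'d" where
  "block M i j = (\<chi> a b. M $ (i, a) $ (j, b))"

definition slice :: "real^'p^('m::finite \<times> 'd::finite) \<Rightarrow> 'm \<Rightarrow> real^'p^'d" where
  "slice Y i = (\<chi> a. Y $ (i, a))"

definition block_diagonal :: "real^('m::finite \<times> 'd::finite)^('m \<times> 'd) \<Rightarrow> bool" where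
  "block_diagonal M \<longleftrightarrow> (\<forall>i j. i \<noteq> j \<longrightarrow> block M i j = 0)"

definition symblockdiag :: "real^('m::finite \<times> 'd::finite)^('m \<times> 'd) \<Rightarrow> real^('m \<times> 'd)^('m \<times> 'd)" where
  "symblockdiag M = (\<chi> r s. if fst r = fst s
     then ((1/2) *\<^sub>R (block M (fst r) (fst r) + transpose (block M (fst r) (fst r)))) $ snd r $ snd s
     else 0)"

definition St :: "(real^'p^('m::finite \<times> 'd::finite)) set" where
  "St = {Y. \<forall>i. slice Y i ** transpose (slice Y i) = mat 1}"

definition feasible :: "(real^('m::finite \<times> 'd::finite)^('m \<times> 'd)) set" where
  "feasible = {X. psd X \<and> (\<forall>i. block X i i = mat 1)}"


(* A cost function on symmetric matrices is a total function of which only the values on syms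
   matter; derivatives are therefore taken within the subspace syms. *)

definition grad :: "(real^'k^'k \<Rightarrow> real) \<Rightarrow> real^'k^'k \<Rightarrow> real^'k^'k" where
  "grad f X = (THE G. G \<in> syms \<and> (f has_derivative (\<lambda>V. G \<bullet> V)) (at X within syms))"

(* For X in syms and twice differentiable f, hess f X V is determined only for V in syms. *)
definition hess :: "(real^'k^'k \<Rightarrow> real) \<Rightarrow> real^'k^'k \<Rightarrow> real^'k^'k \<Rightarrow> real^'k^'k" where
  "hess f X = frechet_derivative (grad f) (at X within syms)"

definition C2_on_syms :: "(real^'k^'k \<Rightarrow> real) \<Rightarrow> bool" where
  "C2_on_syms f \<longleftrightarrow> f differentiable_on syms \<and> grad f differentiable_on syms \<and>
     (\<forall>V\<in>syms. continuous_on syms (\<lambda>X. hess f X V))"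

definition linear_on_syms :: "(real^'k^'k \<Rightarrow> real) \<Rightarrow> bool" where
  "linear_on_syms f \<longleftrightarrow> (\<forall>A\<in>syms. \<forall>B\<in>syms. f (A + B) = f A + f B) \<and>
     (\<forall>c. \<forall>A\<in>syms. f (c *\<^sub>R A) = c * f A)"

definition strictly_convex_on :: "'a::real_vector set \<Rightarrow> ('a \<Rightarrow> real) \<Rightarrow> bool" where
  "strictly_convex_on S f \<longleftrightarrow> convex S \<and>
     (\<forall>x\<in>S. \<forall>y\<in>S. \<forall>u>0. \<forall>v>0. x \<noteq> y \<longrightarrow> u + v = 1 \<longrightarrow>
        f (u *\<^sub>R x + v *\<^sub>R y) < u * f x + v * f y)"

definition strongly_concave_on :: "'a::real_inner set \<Rightarrow> ('a \<Rightarrow> real) \<Rightarrow> bool" where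
  "strongly_concave_on S f \<longleftrightarrow> convex S \<and>
     (\<exists>\<mu>>0. \<forall>x\<in>S. \<forall>y\<in>S. \<forall>u\<ge>0. \<forall>v\<ge>0. u + v = 1 \<longrightarrow>
        f (u *\<^sub>R x + v *\<^sub>R y) \<ge> u * f x + v * f y + \<mu> / 2 * u * v * (norm (x - y))\<^sup>2)"


definition tangent :: "real^'p^('m::finite \<times> 'd::finite) \<Rightarrow> (real^'p^('m \<times> 'd)) set" where
  "tangent Y = {Yd. symblockdiag (Yd ** transpose Y + Y ** transpose Yd) = 0}"

(* Euclidean gradient and Hessian of g(Y) = f(Y Y^T), expressed through those of f. *)

definition grad_g :: "(real^'n^'n \<Rightarrow> real) \<Rightarrow> real^'p^'n \<Rightarrow> real^'p^'n" where
  "grad_g f Y = 2 *\<^sub>R (grad f (Y ** transpose Y) ** Y)"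

definition hess_g :: "(real^'n^'n \<Rightarrow> real) \<Rightarrow> real^'p^'n \<Rightarrow> real^'p^'n \<Rightarrow> real^'p^'n" where
  "hess_g f Y Yd =
     2 *\<^sub>R (hess f (Y ** transpose Y) (Yd ** transpose Y + Y ** transpose Yd) ** Y
         + grad f (Y ** transpose Y) ** Yd)"

definition critical_point ::
    "(real^('m::finite \<times> 'd::finite)^('m \<times> 'd) \<Rightarrow> real) \<Rightarrow> real^'p^('m \<times> 'd) \<Rightarrow> bool" where
  "critical_point f Y \<longleftrightarrow> Y \<in> St \<and>
     (let X = Y ** transpose Y in (grad f X - symblockdiag (grad f X ** X)) ** Y = 0)"

definition second_order_critical_point ::
    "(real^('m::finite \<times> 'd::finite)^('m \<times> 'd) \<Rightarrow> real) \<Rightarrow> real^'p^('m \<times> 'd) \<Rightarrow> bool" where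
  "second_order_critical_point f Y \<longleftrightarrow> critical_point f Y \<and>
     (\<forall>Yd \<in> tangent Y. 0 \<le> Yd \<bullet> (hess_g f Y Yd - symblockdiag (grad_g f Y ** transpose Y) ** Yd))"

definition KKT_point ::
    "(real^('m::finite \<times> 'd::finite)^('m \<times> 'd) \<Rightarrow> real) \<Rightarrow> real^('m \<times> 'd)^('m \<times> 'd) \<Rightarrow> bool" where
  "KKT_point f X \<longleftrightarrow> X \<in> feasible \<and>
     (\<exists>S\<in>syms. \<exists>\<Lambda>\<in>syms. block_diagonal \<Lambda> \<and> S ** X = 0 \<and> S = grad f X + \<Lambda> \<and> psd S)"

definition face_at :: "real^('m::finite \<times> 'd::finite)^('m \<times> 'd) \<Rightarrow> (real^('m \<times> 'd)^('m \<times> 'd)) set" where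
  "face_at X = (THE F. F face_of feasible \<and> X \<in> rel_interior F)"

definition pstar :: "nat \<Rightarrow> nat \<Rightarrow> real" where
  "pstar m d = (sqrt (1 + 4 * real m * real d * (real d + 1)) - 1) / 2"

end

theory Submission
  imports Defs
begin

text \<open>Write \<open>S = \<nabla>f(X) - symblockdiag(\<nabla>f(X)X)\<close>, so that criticality reads \<open>SY = 0\<close>. A matrix \<open>Z\<close> in
  the face of \<open>X\<close> satisfies \<open>ker X \<subseteq> ker Z\<close>, because \<open>X\<close> is a proper convex combination of \<open>Z\<close> and
  another feasible point; hence \<open>\<langle>S, Z\<rangle> = 0\<close>, and since feasible points share their diagonal blocks
  \<open>\<langle>\<nabla>f(X), Z - X\<rangle> = \<langle>S, Z - X\<rangle> = 0\<close>: the face consists of first-order stationary directions.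

  If \<open>Yu = 0\<close> with \<open>u \<noteq> 0\<close>, the tangent vectors \<open>vu\<^sup>T\<close> turn the second-order condition into \<open>S \<succeq> 0\<close>,
  which is the KKT condition and, for linear \<open>f\<close>, gives global optimality.
  If \<open>X\<close> lies inside a segment with direction \<open>B\<close>, then \<open>B = YAY\<^sup>T\<close> for a symmetric \<open>A\<close>, and the tangent
  vector \<open>YA\<close> turns it into \<open>\<langle>B, \<nabla>\<^sup>2f(X)[B]\<rangle> \<ge> 0\<close>, which strong concavity forbids. Finally
  \<open>r = rank Y\<close> gives an \<open>r(r+1)/2\<close>-dimensional space of symmetric matrices with range in that of \<open>Y\<close>,
  against \<open>md(d+1)/2\<close> conditions on the diagonal blocks, so \<open>r > p*\<close> forces a nontrivial face.\<close>

subsection \<open>Matrices and positive semidefiniteness\<close>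

lemma scaleR_matrix_mult: "(c *\<^sub>R A) ** B = c *\<^sub>R (A ** B)" for A :: "real^'n^'m" and B :: "real^'k^'n"
  by (simp add: vec_eq_iff matrix_matrix_mult_def sum_distrib_left mult.assoc)

lemma matrix_mult_scaleR: "A ** (c *\<^sub>R B) = c *\<^sub>R (A ** B)" for A :: "real^'n^'m" and B :: "real^'k^'n"
  by (simp add: vec_eq_iff matrix_matrix_mult_def sum_distrib_left algebra_simps)

lemma add_matrix_mult: "(A + B) ** C = A ** C + B ** C" for A :: "real^'n^'m" and C :: "real^'k^'n"
  by (simp add: vec_eq_iff matrix_matrix_mult_def sum.distrib algebra_simps)

lemma diff_matrix_mult: "(A - B) ** C = A ** C - B ** C" for A :: "real^'n^'m" and C :: "real^'k^'n"
  by (simp add: vec_eq_iff matrix_matrix_mult_def sum_subtractf algebra_simps)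

lemma matrix_mult_diff: "A ** (B - C) = A ** B - A ** C" for A :: "real^'n^'m" and C :: "real^'k^'n"
  by (simp add: vec_eq_iff matrix_matrix_mult_def sum_subtractf algebra_simps)

lemma zero_matrix_mult [simp]: "0 ** C = 0" for C :: "real^'k^'n"
  by (simp add: vec_eq_iff matrix_matrix_mult_def)

lemma matrix_mult_zero [simp]: "A ** 0 = 0" for A :: "real^'n^'m"
  by (simp add: vec_eq_iff matrix_matrix_mult_def)

lemma transpose_add: "transpose (A + B) = transpose A + transpose B" for A B :: "real^'n^'m"
  by (simp add: vec_eq_iff transpose_def)

lemma transpose_diff: "transpose (A - B) = transpose A - transpose B" for A B :: "real^'n^'m"
  by (simp add: vec_eq_iff transpose_def)

lemma transpose_0 [simp]: "transpose (0::real^'n^'m) = 0"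
  by (simp add: vec_eq_iff transpose_def)

lemma inner_matrix_mult_right: "(A ** B) \<bullet> C = A \<bullet> (C ** transpose B)"
  for A :: "real^'n^'m" and B :: "real^'k^'n"
proof -
  have "(A ** B) \<bullet> C = (\<Sum>i\<in>UNIV. \<Sum>j\<in>UNIV. \<Sum>k\<in>UNIV. A$i$k * B$k$j * C$i$j)"
    by (simp add: inner_vec_def matrix_matrix_mult_def sum_distrib_right)
  also have "\<dots> = (\<Sum>i\<in>UNIV. \<Sum>k\<in>UNIV. \<Sum>j\<in>UNIV. A$i$k * B$k$j * C$i$j)"
    by (intro sum.cong sum.swap refl)
  also have "\<dots> = A \<bullet> (C ** transpose B)"
    by (simp add: inner_vec_def matrix_matrix_mult_def transpose_def sum_distrib_left algebra_simps)
  finally show ?thesis .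
qed

lemma inner_transpose: "transpose A \<bullet> transpose B = A \<bullet> B" for A B :: "real^'n^'m"
  unfolding inner_vec_def transpose_def by (simp, rule sum.swap)

lemma mem_syms: "M \<in> syms \<longleftrightarrow> (\<forall>i j. M $ i $ j = M $ j $ i)"
  by (auto simp: syms_def vec_eq_iff transpose_def)

lemma subspace_syms: "subspace syms"
  by (auto simp: subspace_def mem_syms)

lemma syms_inner_move: "x \<bullet> (M *v y) = (M *v x) \<bullet> y" if "M \<in> syms"
proof -
  have "M *v x = x v* M" using that transpose_matrix_vector[of M x] by (simp add: syms_def)
  then show ?thesis by (simp add: dot_lmul_matrix)
qed

lemma psd_syms: "psd P \<Longrightarrow> P \<in> syms"
  and psd_nonneg: "psd P \<Longrightarrow> 0 \<le> x \<bullet> (P *v x)"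
  by (auto simp: psd_def)

lemma scaleR_matrix_vector: "(c *\<^sub>R A) *v x = c *\<^sub>R (A *v x)" for A :: "real^'n^'m"
  by (simp add: scaleR_matrix_vector_assoc)

lemma psd_add: "psd P \<Longrightarrow> psd Q \<Longrightarrow> psd (P + Q)"
  by (simp add: psd_def subspace_add[OF subspace_syms] matrix_vector_mult_add_rdistrib inner_add_right)

lemma psd_scaleR: "psd P \<Longrightarrow> 0 \<le> c \<Longrightarrow> psd (c *\<^sub>R P)"
  by (simp add: psd_def subspace_scale[OF subspace_syms] scaleR_matrix_vector)

text \<open>Near \<open>t = 0\<close> the linear term dominates and changes sign with
  \<open>t\<close>, so nonnegativity forces it to vanish.\<close>

lemma quadratic_nonneg_imp_linear_term_zero:
  fixes a c :: real
  assumes "\<And>t. 0 \<le> 2 * t * a + t\<^sup>2 * c"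
  shows "a = 0"
proof (rule ccontr)
  assume "a \<noteq> 0"
  \<comment> \<open>Any \<open>s > 0\<close> with \<open>c < 2 * s\<close> serves: the test value
    \<open>t = - a / s\<close> then makes the quadratic negative.\<close>
  define s where "s = \<bar>c\<bar> + 1"
  have s: "s > 0" "c < 2 * s" by (auto simp: s_def)
  have "2 * (- a / s) * a + (- a / s)\<^sup>2 * c = (a\<^sup>2 / s\<^sup>2) * (c - 2 * s)"
    using s by (simp add: field_simps power2_eq_square)
  also have "\<dots> < 0" using s \<open>a \<noteq> 0\<close> by (intro mult_pos_neg) auto
  finally show False using assms[of "- a / s"] by linarith
qed

text \<open>The quadratic form is minimal at \<open>x\<close>, so its first-order change along
  \<open>P *v x\<close>, a multiple of the squared norm of \<open>P *v x\<close>, must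
  vanish.\<close>

lemma psd_quadratic_zero:
  assumes P: "psd P" and 0: "x \<bullet> (P *v x) = 0"
  shows "P *v x = 0"
proof -
  have "0 \<le> 2 * t * ((P *v x) \<bullet> (P *v x)) + t\<^sup>2 * ((P *v x) \<bullet> (P *v (P *v x)))" for t
  proof -
    let ?y = "P *v x"
    have "0 \<le> (x + t *\<^sub>R ?y) \<bullet> (P *v (x + t *\<^sub>R ?y))" by (rule psd_nonneg[OF P])
    also have "\<dots> = 2 * t * (?y \<bullet> ?y) + t\<^sup>2 * (?y \<bullet> (P *v ?y))"
      using 0 syms_inner_move[OF psd_syms[OF P], of x ?y]
      by (simp add: matrix_vector_right_distrib matrix_vector_mult_scaleR inner_add_left inner_add_right
            power2_eq_square algebra_simps)
    finally show ?thesis .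
  qed
  from quadratic_nonneg_imp_linear_term_zero[OF this] show ?thesis by simp
qed

text \<open>Two nonnegative quadratic forms with sum 0 at \<open>x\<close> both vanish there. Kernel
  inclusions for faces and for segments through a point come from this.\<close>

lemma psd_sum_kernel:
  assumes P: "psd P" and Q: "psd Q" and x: "(P + Q) *v x = 0"
  shows "P *v x = 0" "Q *v x = 0"
proof -
  have "x \<bullet> (P *v x) + x \<bullet> (Q *v x) = 0"
    using x by (metis inner_add_right inner_zero_right matrix_vector_mult_add_rdistrib)
  then have "x \<bullet> (P *v x) = 0" "x \<bullet> (Q *v x) = 0"
    using psd_nonneg[OF P, of x] psd_nonneg[OF Q, of x] by linarith+
  then show "P *v x = 0" "Q *v x = 0" by (simp_all add: psd_quadratic_zero P Q)
qed

section \<open>Rank-one matrices and the pairing of positive semidefinite matrices\<close>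

definition outer :: "real^'m \<Rightarrow> real^'n \<Rightarrow> real^'n^'m" where
  "outer x y = (\<chi> i j. x $ i * y $ j)"

lemma inner_outer: "outer x y \<bullet> M = x \<bullet> (M *v y)"
  by (simp add: outer_def inner_vec_def matrix_vector_mult_def sum_distrib_left algebra_simps)

lemma outer_vector: "outer x y *v z = (y \<bullet> z) *\<^sub>R x"
  by (simp add: outer_def inner_vec_def matrix_vector_mult_def vec_eq_iff sum_distrib_left algebra_simps)

lemma inner_outer_outer: "outer x y \<bullet> outer z w = (x \<bullet> z) * (y \<bullet> w)"
  by (simp add: inner_outer outer_vector inner_commute)

lemma matrix_mult_outer: "A ** outer x y = outer (A *v x) y"
  by (simp add: outer_def vec_eq_iff matrix_matrix_mult_def matrix_vector_mult_def sum_distrib_left algebra_simps)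

lemma outer_mult_transpose: "outer x y ** transpose A = outer x (A *v y)"
  by (simp add: outer_def vec_eq_iff matrix_matrix_mult_def matrix_vector_mult_def transpose_def
      sum_distrib_left algebra_simps)

lemma transpose_outer: "transpose (outer x y) = outer y x"
  by (simp add: outer_def vec_eq_iff transpose_def)

lemma outer_zero [simp]: "outer x 0 = 0" "outer 0 y = 0"
  by (simp_all add: outer_def vec_eq_iff)

text \<open>Completing the square: the new quadratic form at \<open>x\<close> is the least value of
  the old one on the line through \<open>x\<close> in direction \<open>axis k 1\<close>.\<close>

lemma psd_column_deflation:
  fixes Z :: "real^'n^'n"
  assumes Z: "psd Z" and k: "0 < Z $ k $ k"
  defines "z \<equiv> Z *v axis k 1"
  shows "psd (Z - (1 / Z $ k $ k) *\<^sub>R outer z z)"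
proof -
  let ?c = "Z $ k $ k"
  have sym: "Z \<in> syms" by (rule psd_syms[OF Z])
  have zk: "axis k 1 \<bullet> z = ?c"
    by (simp add: z_def inner_axis' matrix_vector_mult_basis column_def)
  have "0 \<le> x \<bullet> ((Z - (1 / ?c) *\<^sub>R outer z z) *v x)" for x
  proof -
    \<comment> \<open>The form of \<open>Z\<close> on that line is minimal at
      \<open>x - s *\<^sub>R axis k 1\<close>.\<close>
    define s where "s = (x \<bullet> z) / ?c"
    have xz: "x \<bullet> z = s * ?c" using k by (simp add: s_def)
    have kx: "axis k 1 \<bullet> (Z *v x) = x \<bullet> z"
      using syms_inner_move[OF sym, of "axis k 1" x] by (simp add: z_def inner_commute)
    have "0 \<le> (x - s *\<^sub>R axis k 1) \<bullet> (Z *v (x - s *\<^sub>R axis k 1))" by (rule psd_nonneg[OF Z])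
    also have "\<dots> = x \<bullet> (Z *v x) - s * (x \<bullet> z) - s * (x \<bullet> z) + s * s * ?c"
      using zk kx
      by (simp add: matrix_vector_mult_diff_distrib matrix_vector_mult_scaleR inner_diff_left inner_diff_right
          z_def[symmetric] algebra_simps)
    also have "\<dots> = x \<bullet> (Z *v x) - s * s * ?c"
      by (simp add: xz)
    also have "\<dots> = x \<bullet> (Z *v x) - (x \<bullet> z) * (x \<bullet> z) / ?c"
      using k by (simp add: s_def)
    finally show ?thesis
      by (simp add: matrix_vector_mult_diff_rdistrib scaleR_matrix_vector outer_vector inner_diff_right
          inner_commute)
  qed
  moreover have "outer z z \<in> syms" by (simp add: syms_def transpose_outer)
  ultimately show ?thesis
    unfolding psd_def using subspace_syms sym by (auto intro!: subspace_diff subspace_scale)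
qed

lemma psd_component:
  "M $ i $ j = axis i 1 \<bullet> (M *v axis j 1)" for M :: "real^'n^'n"
  by (simp add: inner_axis' matrix_vector_mult_basis column_def)

text \<open>Induction on the number of nonzero diagonal entries, peeling off rank-one summands as in
  the Cholesky factorization; this avoids the spectral theorem.\<close>

lemma psd_inner_nonneg:
  fixes S Z :: "real^'n^'n"
  assumes S: "psd S" and "psd Z"
  shows "0 \<le> S \<bullet> Z"
  using \<open>psd Z\<close>
proof (induction "card {k. Z $ k $ k \<noteq> 0}" arbitrary: Z rule: less_induct)
  case (less Z)
  have diag: "0 \<le> Z $ k $ k" for k
    using psd_nonneg[OF less.prems] by (simp add: psd_component[of Z])
  have col: "Z *v axis k 1 = 0" if "Z $ k $ k = 0" for k
    using psd_quadratic_zero[OF less.prems, of "axis k 1"] that by (simp add: psd_component[of Z])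
  show ?case
  proof (cases "\<forall>k. Z $ k $ k = 0")
    case True
    then have "Z $ i $ j = 0" for i j using col[of j] by (simp add: psd_component[of Z])
    then show ?thesis by (simp add: inner_vec_def)
  next
    case False
    then obtain k where k: "0 < Z $ k $ k" using diag by (metis order_less_le)
    define z where "z = Z *v axis k 1"
    define Z' where "Z' = Z - (1 / Z $ k $ k) *\<^sub>R outer z z"
    have Z': "psd Z'" unfolding Z'_def z_def by (rule psd_column_deflation[OF less.prems k])
    have zi: "z $ i = Z $ i $ k" for i
      by (simp add: z_def matrix_vector_mult_basis column_def)
    \<comment> \<open>A zero diagonal entry forces a zero column, so \<open>z $ i = 0\<close> and
      the entry stays zero; entry \<open>k\<close> becomes zero as well, and the induction measure
      drops.\<close>
    have "Z' $ i $ i = 0" if "Z $ i $ i = 0" for i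
    proof -
      have "z $ i = Z $ k $ i" using psd_syms[OF less.prems] by (simp add: zi mem_syms)
      also have "\<dots> = 0" using col[OF that] by (simp add: psd_component[of Z])
      finally show ?thesis using that by (simp add: Z'_def outer_def)
    qed
    moreover have "Z' $ k $ k = 0" using k by (simp add: Z'_def outer_def zi)
    ultimately have "{i. Z' $ i $ i \<noteq> 0} \<subset> {i. Z $ i $ i \<noteq> 0}" using k by force
    then have "card {i. Z' $ i $ i \<noteq> 0} < card {i. Z $ i $ i \<noteq> 0}" by (intro psubset_card_mono) auto
    from less.hyps[OF this Z'] have "0 \<le> S \<bullet> Z'" .
    moreover have "0 \<le> (1 / Z $ k $ k) * (S \<bullet> outer z z)"
      using psd_nonneg[OF S, of z] k by (simp add: inner_commute[of S] inner_outer)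
    moreover have "S \<bullet> Z = S \<bullet> Z' + (1 / Z $ k $ k) * (S \<bullet> outer z z)"
      by (simp add: Z'_def inner_diff_right)
    ultimately show ?thesis by linarith
  qed
qed

section \<open>Perturbation of the identity, congruence and factorization\<close>

lemma mat_syms: "mat c \<in> syms"
  by (simp add: syms_def)

text \<open>An operator bound of \<open>A\<close> dominates its quadratic form in absolute value by
  Cauchy-Schwarz, hence one \<open>t\<close> serves both signs.\<close>

lemma psd_mat_perturbation:
  assumes A: "A \<in> syms"
  obtains t where "0 < t" "psd (t *\<^sub>R mat 1 + A)" "psd (t *\<^sub>R mat 1 - A)"
proof -
  obtain K where K: "0 < K" "\<And>x. norm (A *v x) \<le> norm x * K"
    using bounded_linear.pos_bounded[OF matrix_vector_mul_bounded_linear, of A] by blast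
  have bound: "\<bar>x \<bullet> (A *v x)\<bar> \<le> K * (x \<bullet> x)" for x
  proof -
    have "\<bar>x \<bullet> (A *v x)\<bar> \<le> norm x * norm (A *v x)" by (rule Cauchy_Schwarz_ineq2)
    also have "\<dots> \<le> norm x * (norm x * K)" by (intro mult_left_mono K) auto
    finally show ?thesis by (simp add: dot_square_norm power2_eq_square mult_ac)
  qed
  show thesis
  proof (rule that[OF K(1)])
    have q: "x \<bullet> ((K *\<^sub>R mat 1 + A) *v x) = K * (x \<bullet> x) + x \<bullet> (A *v x)"
      "x \<bullet> ((K *\<^sub>R mat 1 - A) *v x) = K * (x \<bullet> x) - x \<bullet> (A *v x)" for x
      by (simp_all add: matrix_vector_mult_add_rdistrib matrix_vector_mult_diff_rdistrib
          scaleR_matrix_vector inner_add_right inner_diff_right)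
    show "psd (K *\<^sub>R mat 1 + A)" "psd (K *\<^sub>R mat 1 - A)"
      using bound subspace_syms mat_syms A unfolding psd_def q
      by (auto intro!: subspace_add subspace_diff subspace_scale simp: abs_le_iff)
         (metis add.commute diff_ge_0_iff_ge diff_minus_eq_add)
  qed
qed

lemma syms_congruence: "A \<in> syms \<Longrightarrow> Y ** A ** transpose Y \<in> syms"
  by (simp add: syms_def matrix_transpose_mul matrix_mul_assoc)

lemma psd_congruence:
  assumes "psd A"
  shows "psd (Y ** A ** transpose Y)"
proof -
  have "x \<bullet> ((Y ** A ** transpose Y) *v x) = (transpose Y *v x) \<bullet> (A *v (transpose Y *v x))" for x
    by (simp add: matrix_vector_mul_assoc[symmetric] dot_lmul_matrix del: transpose_matrix_vector)
       (simp add: dot_lmul_matrix)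
  then show ?thesis
    using assms by (simp add: psd_def syms_congruence del: transpose_matrix_vector)
qed

lemma mat_1_psd: "psd (mat 1)"
  by (simp add: psd_def mat_syms)

text \<open>A generalized inverse \<open>Q\<close> of \<open>Y\<close> does the factoring: the
  kernel condition gives \<open>B = B ** transpose Q ** transpose Y\<close>, symmetry gives
  \<open>B = Y ** Q ** B\<close>, and together \<open>A = Q ** B ** transpose Q\<close>. This later
  turns a segment direction \<open>B\<close> at \<open>Y ** transpose Y\<close> into a tangent
  vector \<open>Y ** A\<close>.\<close>

lemma kernel_imp_congruence:
  fixes Y :: "real^'p^'n" and B :: "real^'n^'n"
  assumes B: "B \<in> syms" and ker: "\<And>x. (Y ** transpose Y) *v x = 0 \<Longrightarrow> B *v x = 0"
  obtains A where "A \<in> syms" "B = Y ** A ** transpose Y"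
proof -
  obtain g where g: "linear g" "\<And>v. v \<in> range ((*v) Y) \<Longrightarrow> Y *v g v = v"
    using linear_exists_right_inverse_on[OF matrix_vector_mul_linear subspace_UNIV, of Y] by blast
  define Q where "Q = matrix g"
  have "(Y ** Q ** Y) *v v = Y *v v" for v
    using g by (simp add: Q_def matrix_works matrix_vector_mul_assoc[symmetric])
  then have YQY: "Y ** Q ** Y = Y" by (simp add: matrix_eq)
  \<comment> \<open>Because \<open>Y ** Q ** Y = Y\<close>, the columns of
    \<open>mat 1 - transpose Q ** transpose Y\<close> lie in the kernel of
    \<open>Y ** transpose Y\<close>.\<close>
  have "(Y ** transpose Y) ** (mat 1 - transpose Q ** transpose Y) = Y ** transpose (Y - Y ** Q ** Y)"
    by (simp add: matrix_mult_diff transpose_diff matrix_transpose_mul matrix_mul_assoc)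
  then have "(Y ** transpose Y) ** (mat 1 - transpose Q ** transpose Y) = 0"
    by (simp add: YQY)
  then have "(Y ** transpose Y) *v ((mat 1 - transpose Q ** transpose Y) *v x) = 0" for x
    by (simp add: matrix_vector_mul_assoc)
  then have "B *v ((mat 1 - transpose Q ** transpose Y) *v x) = 0" for x by (rule ker)
  then have "B ** (mat 1 - transpose Q ** transpose Y) = 0"
    by (simp add: matrix_vector_mul_assoc matrix_eq)
  then have right: "B = B ** transpose Q ** transpose Y"
    by (simp add: matrix_mult_diff matrix_mul_assoc)
  then have "transpose B = transpose (B ** transpose Q ** transpose Y)" by simp
  then have left: "B = Y ** Q ** B" using B by (simp add: matrix_transpose_mul syms_def matrix_mul_assoc)
  have "B = Y ** (Q ** B ** transpose Q) ** transpose Y"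
    using left right by (metis matrix_mul_assoc)
  then show thesis using that[OF syms_congruence[OF B, of Q]] by simp
qed

subsection \<open>Minimal faces and derivatives along a subspace\<close>

text \<open>The new point lies between \<open>x\<close> and the one at \<open>t\<close>. This lets
  two points of a face share one prolongation length.\<close>

lemma minimal_face_shrink:
  fixes x z :: "'a::real_vector"
  assumes "convex S" "x \<in> S" "x + t *\<^sub>R (x - z) \<in> S" "0 \<le> s" "s \<le> t" "0 < t"
  shows "x + s *\<^sub>R (x - z) \<in> S"
proof -
  have "(1 - s / t) *\<^sub>R x + (s / t) *\<^sub>R (x + t *\<^sub>R (x - z)) \<in> S"
    using assms by (intro convexD_alt) (auto simp: field_simps)
  moreover have "(1 - s / t) *\<^sub>R x + (s / t) *\<^sub>R (x + t *\<^sub>R (x - z)) = x + s *\<^sub>R (x - z)"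
    using \<open>0 < t\<close> by (simp add: algebra_simps)
  ultimately show ?thesis by simp
qed

text \<open>\<open>F\<close> collects the points whose segment to \<open>x\<close> can be prolonged
  beyond \<open>x\<close> inside \<open>S\<close>; this is the smallest face through
  \<open>x\<close>.\<close>

lemma minimal_face:
  fixes x :: "'a::euclidean_space"
  assumes S: "convex S" and x: "x \<in> S"
  defines "F \<equiv> {z \<in> S. \<exists>t>0. x + t *\<^sub>R (x - z) \<in> S}"
  shows "F face_of S" and "x \<in> rel_interior F"
proof -
  have convF: "convex F"
  proof (rule convexI)
    fix a b :: 'a and u v :: real
    assume a: "a \<in> F" and b: "b \<in> F" and uv: "0 \<le> u" "0 \<le> v" "u + v = 1"
    from a b obtain s t where st: "0 < s" "0 < t"
      and A: "x + s *\<^sub>R (x - a) \<in> S" and B: "x + t *\<^sub>R (x - b) \<in> S"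
      by (auto simp: F_def)
    define r where "r = min s t"
    have r: "0 < r" "r \<le> s" "r \<le> t" using st by (auto simp: r_def)
    have "u *\<^sub>R (x + r *\<^sub>R (x - a)) + v *\<^sub>R (x + r *\<^sub>R (x - b)) \<in> S"
      using minimal_face_shrink[OF S x A, of r] minimal_face_shrink[OF S x B, of r] r st uv
      by (intro convexD[OF S]) auto
    also have "u *\<^sub>R (x + r *\<^sub>R (x - a)) + v *\<^sub>R (x + r *\<^sub>R (x - b))
        = (u + v) *\<^sub>R x + r *\<^sub>R ((u + v) *\<^sub>R x - (u *\<^sub>R a + v *\<^sub>R b))"
      by (simp add: algebra_simps)
    finally have "x + r *\<^sub>R (x - (u *\<^sub>R a + v *\<^sub>R b)) \<in> S" using uv by simp
    moreover have "u *\<^sub>R a + v *\<^sub>R b \<in> S" using a b uv by (intro convexD[OF S]) (auto simp: F_def)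
    ultimately show "u *\<^sub>R a + v *\<^sub>R b \<in> F" using r by (auto simp: F_def)
  qed
  have left: "a \<in> F" if "a \<in> S" "b \<in> S" "w \<in> F" "w \<in> open_segment a b" for a b w
  proof -
    from \<open>w \<in> open_segment a b\<close> obtain u where u: "0 < u" "u < 1" and w: "w = (1 - u) *\<^sub>R a + u *\<^sub>R b"
      by (auto simp: in_segment)
    from \<open>w \<in> F\<close> obtain t where t: "0 < t" and W: "x + t *\<^sub>R (x - w) \<in> S" by (auto simp: F_def)
    \<comment> \<open>\<open>c\<close> normalizes the weights \<open>1 / c\<close> and
      \<open>t * u / c\<close>, chosen so that the \<open>b\<close> part of \<open>w\<close>
      cancels; the combination then lies on the line from \<open>a\<close> through \<open>x\<close>,
      beyond \<open>x\<close>.\<close>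
    define c where "c = 1 + t * u"
    have c: "c > 0" using t u by (simp add: c_def add_pos_pos)
    define s where "s = t * (1 - u) / c"
    have s: "s > 0" using t u c by (simp add: s_def)
    have "(1 / c) *\<^sub>R (x + t *\<^sub>R (x - w)) + (t * u / c) *\<^sub>R b \<in> S"
      using W \<open>b \<in> S\<close> t u c by (intro convexD[OF S]) (auto simp: field_simps c_def)
    also have "(1 / c) *\<^sub>R (x + t *\<^sub>R (x - w)) + (t * u / c) *\<^sub>R b
        = ((1 + t) / c) *\<^sub>R x - s *\<^sub>R a"
    proof -
      have "x + t *\<^sub>R (x - w) = (1 + t) *\<^sub>R x - (t * (1 - u)) *\<^sub>R a - (t * u) *\<^sub>R b"
        by (simp add: w algebra_simps)
      then show ?thesis by (simp add: s_def scaleR_diff_right)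
    qed
    also have "(1 + t) / c = 1 + s" 
    proof -
      have "c * s = t * (1 - u)" using c by (simp add: s_def)
      then have "c * (1 + s) = 1 + t" by (simp add: distrib_left) (simp add: c_def algebra_simps)
      then show ?thesis using c by (simp add: nonzero_divide_eq_eq mult.commute)
    qed
    also have "(1 + s) *\<^sub>R x - s *\<^sub>R a = x + s *\<^sub>R (x - a)" by (simp add: algebra_simps)
    finally show ?thesis using s \<open>a \<in> S\<close> by (auto simp: F_def)
  qed
  show "F face_of S"
    unfolding face_of_def
  proof (intro conjI ballI impI)
    show "F \<subseteq> S" by (auto simp: F_def)
    show "convex F" by (rule convF)
    fix a b w assume "a \<in> S" "b \<in> S" "w \<in> F" "w \<in> open_segment a b"
    then show "a \<in> F" "b \<in> F" using left[of a b w] left[of b a w] open_segment_commute[of a b] by blast+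
  qed
  have "x \<in> F" using x by (auto simp: F_def intro!: exI[of _ 1])
  \<comment> \<open>Criterion for the relative interior: every segment from \<open>z \<in> F\<close>
    to \<open>x\<close> continues beyond \<open>x\<close> inside \<open>F\<close>. The prolonged
    point is in \<open>F\<close> because prolonging back from it by \<open>1 / t\<close> gives
    \<open>z\<close>.\<close>
  moreover have "\<exists>e>1. (1 - e) *\<^sub>R z + e *\<^sub>R x \<in> F" if "z \<in> F" for z
  proof -
    from that obtain t where t: "0 < t" and Z: "x + t *\<^sub>R (x - z) \<in> S" "z \<in> S" by (auto simp: F_def)
    have "x + (1 / t) *\<^sub>R (x - (x + t *\<^sub>R (x - z))) = z" using t by simp
    then have "x + t *\<^sub>R (x - z) \<in> F" using Z t by (auto simp: F_def intro!: exI[of _ "1 / t"])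
    moreover have "(1 - (1 + t)) *\<^sub>R z + (1 + t) *\<^sub>R x = x + t *\<^sub>R (x - z)" by (simp add: algebra_simps)
    ultimately show ?thesis using t by (intro exI[of _ "1 + t"]) auto
  qed
  ultimately show "x \<in> rel_interior F" using convex_rel_interior_iff[OF convF, of x] by blast
qed

text \<open>The line stays in \<open>S\<close>, so a derivative within \<open>S\<close> fixes its
  difference quotients even when \<open>S\<close> has empty interior. This yields uniqueness of
  gradients on \<open>syms\<close> and turns concavity into derivative bounds.\<close>

lemma has_derivative_along_line:
  fixes F :: "'a::real_normed_vector \<Rightarrow> 'b::real_normed_vector"
  assumes S: "subspace S" and x: "x \<in> S" and v: "v \<in> S"
    and F: "(F has_derivative D) (at x within S)"
  shows "((\<lambda>t. (1 / t) *\<^sub>R (F (x + t *\<^sub>R v) - F x)) \<longlongrightarrow> D v) (at_right 0)"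
proof -
  have "((\<lambda>t::real. x + t *\<^sub>R v) has_derivative (\<lambda>t. t *\<^sub>R v)) (at 0 within {0<..})"
    by (auto intro!: derivative_eq_intros)
  moreover have "(F has_derivative D) (at (x + 0 *\<^sub>R v) within (\<lambda>t. x + t *\<^sub>R v) ` {0<..})"
    using x v by (auto intro!: has_derivative_subset[OF F] subspace_add[OF S] subspace_scale[OF S])
  ultimately have "((\<lambda>t. F (x + t *\<^sub>R v)) has_derivative (\<lambda>t. D (t *\<^sub>R v))) (at 0 within {0<..})"
    by (rule has_derivative_in_compose)
  then have "((\<lambda>t. (F (x + t *\<^sub>R v) - F x - t *\<^sub>R D v) /\<^sub>R norm t) \<longlongrightarrow> 0) (at_right 0)"
    using linear_scale[OF has_derivative_linear[OF F]] by (simp add: has_derivative_at_within)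
  moreover have "\<forall>\<^sub>F t in at_right 0. (F (x + t *\<^sub>R v) - F x - t *\<^sub>R D v) /\<^sub>R norm t
      = (1 / t) *\<^sub>R (F (x + t *\<^sub>R v) - F x) - D v"
    by (intro eventually_at_rightI[of 0 1]) (auto simp: scaleR_diff_right divide_inverse)
  ultimately have "((\<lambda>t. (1 / t) *\<^sub>R (F (x + t *\<^sub>R v) - F x) - D v) \<longlongrightarrow> 0) (at_right 0)"
    by (rule Lim_transform_eventually)
  then show ?thesis by (rule LIM_zero_cancel)
qed

text \<open>The same inequality serves strong concavity and, with \<^term>\<open>\<mu> = 0\<close>, concavity.\<close>

lemma strongly_concave_gradient_inequality:
  fixes f :: "'a::real_normed_vector \<Rightarrow> real"
  assumes S: "subspace S" and x: "x \<in> S" and y: "y \<in> S"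
    and f: "(f has_derivative D) (at x within S)"
    and conc: "\<And>u v. 0 \<le> u \<Longrightarrow> 0 \<le> v \<Longrightarrow> u + v = 1 \<Longrightarrow>
      f (u *\<^sub>R x + v *\<^sub>R y) \<ge> u * f x + v * f y + \<mu> / 2 * u * v * (norm (x - y))\<^sup>2"
  shows "f y + \<mu> / 2 * (norm (x - y))\<^sup>2 \<le> f x + D (y - x)"
proof -
  have lim: "((\<lambda>t. (1 / t) *\<^sub>R (f (x + t *\<^sub>R (y - x)) - f x)) \<longlongrightarrow> D (y - x)) (at_right 0)"
    using has_derivative_along_line[OF S x _ f] x y S by (simp add: subspace_diff)
  \<comment> \<open>Concavity bounds the difference quotient below by this affine function of
    \<open>t\<close>; letting \<open>t\<close> tend to 0 recovers the full quadratic term.\<close>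
  have low: "((\<lambda>t. f y - f x + \<mu> / 2 * (1 - t) * (norm (x - y))\<^sup>2) \<longlongrightarrow>
      f y - f x + \<mu> / 2 * (1 - 0) * (norm (x - y))\<^sup>2) (at_right 0)"
    by (intro tendsto_intros)
  have "f y - f x + \<mu> / 2 * (1 - t) * (norm (x - y))\<^sup>2 \<le> (1 / t) *\<^sub>R (f (x + t *\<^sub>R (y - x)) - f x)"
    if t: "t \<in> {0<..<1}" for t
  proof -
    have eq: "(1 - t) *\<^sub>R x + t *\<^sub>R y = x + t *\<^sub>R (y - x)" by (simp add: algebra_simps)
    have "(1 - t) * f x + t * f y + \<mu> / 2 * (1 - t) * t * (norm (x - y))\<^sup>2 \<le> f (x + t *\<^sub>R (y - x))"
      using conc[of "1 - t" t] t unfolding eq by auto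
    then have "t * (f y - f x + \<mu> / 2 * (1 - t) * (norm (x - y))\<^sup>2) \<le> f (x + t *\<^sub>R (y - x)) - f x"
      by (simp add: algebra_simps)
    then show ?thesis using t by (simp add: field_simps)
  qed
  then have "\<forall>\<^sub>F t in at_right 0. f y - f x + \<mu> / 2 * (1 - t) * (norm (x - y))\<^sup>2
      \<le> (1 / t) *\<^sub>R (f (x + t *\<^sub>R (y - x)) - f x)"
    by (intro eventually_at_rightI[of 0 1]) auto
  from tendsto_le[OF _ lim low this] show ?thesis by simp
qed

text \<open>Upper triangular positions, diagonal included: one for each basis element of the
  symmetric \<open>n\<close> by \<open>n\<close> matrices.\<close>

definition triangle :: "nat \<Rightarrow> (nat \<times> nat) set" where
  "triangle n = {(i, j). i \<le> j \<and> j < n}"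

lemma triangle_eq: "triangle n = (SIGMA j:{..<n}. {..j})\<inverse>"
  by (auto simp: triangle_def)

lemma finite_triangle [simp]: "finite (triangle n)"
  by (simp add: triangle_eq)

lemma card_triangle: "2 * card (triangle n) = n * (n + 1)"
proof -
  have "card (triangle n) = (\<Sum>j<n. Suc j)" by (simp add: triangle_eq)
  moreover have "2 * (\<Sum>j<n. Suc j) = n * (n + 1)" by (induction n) auto
  ultimately show ?thesis by simp
qed

subsection \<open>Counting dimensions\<close>

text \<open>Left unnormalized: for \<open>x = y\<close> it is twice the rank-one matrix, which
  affects neither spans nor independence.\<close>

definition sym_outer :: "real^'n \<Rightarrow> real^'n \<Rightarrow> real^'n^'n" where
  "sym_outer x y = outer x y + outer y x"

lemma sym_outer_commute: "sym_outer x y = sym_outer y x"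
  by (simp add: sym_outer_def add.commute)

lemma sym_outer_syms: "sym_outer x y \<in> syms"
  by (simp add: sym_outer_def syms_def transpose_add transpose_outer)

lemma inner_sym_outer:
  "sym_outer x y \<bullet> sym_outer z w = 2 * ((x \<bullet> z) * (y \<bullet> w) + (x \<bullet> w) * (y \<bullet> z))"
  by (simp add: sym_outer_def inner_add_left inner_add_right inner_outer_outer algebra_simps)

lemma congruence_sym_outer: "Y ** sym_outer u v ** transpose Y = sym_outer (Y *v u) (Y *v v)"
  by (simp add: sym_outer_def matrix_add_ldistrib add_matrix_mult matrix_mult_outer outer_mult_transpose)

text \<open>Distinct pairs in \<open>triangle r\<close> give orthogonal matrices; ordering the
  indices excludes swapped pairs, which would repeat a matrix.\<close>

lemma independent_sym_outer:
  fixes b :: "nat \<Rightarrow> real^'n"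
  assumes b: "\<And>i j. i < r \<Longrightarrow> j < r \<Longrightarrow> b i \<bullet> b j = (if i = j then 1 else 0)"
  defines "E \<equiv> (\<lambda>(i, j). sym_outer (b i) (b j)) ` triangle r"
  shows "independent E" and "card E = card (triangle r)"
proof -
  let ?g = "\<lambda>(i, j). sym_outer (b i) (b j)"
  have orth: "?g p \<bullet> ?g q = 0" if "p \<in> triangle r" "q \<in> triangle r" "p \<noteq> q" for p q
    using that by (auto simp: triangle_def inner_sym_outer b split: if_splits)
  have nz: "?g p \<noteq> 0" if p_in: "p \<in> triangle r" for p
  proof -
    obtain i j where p: "p = (i, j)" "i < r" "j < r"
      using p_in unfolding triangle_def by fastforce
    have "sym_outer (b i) (b j) \<bullet> sym_outer (b i) (b j) > 0"
      unfolding inner_sym_outer using p by (simp add: b)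
    then show ?thesis unfolding p(1) by (metis case_prod_conv inner_zero_left less_irrefl)
  qed
  have inj: "inj_on ?g (triangle r)"
  proof (rule inj_onI, rule ccontr)
    fix p q assume pq: "p \<in> triangle r" "q \<in> triangle r" "?g p = ?g q" "p \<noteq> q"
    then have "?g p \<bullet> ?g p = 0" using orth[of p q] by simp
    then show False using nz[OF pq(1)] by simp
  qed
  show "independent E"
    unfolding E_def
    by (rule pairwise_orthogonal_independent) (use orth nz in \<open>fastforce simp: pairwise_def orthogonal_def\<close>)+
  show "card E = card (triangle r)" unfolding E_def by (rule card_image[OF inj])
qed

section \<open>Block structure and the map \<open>symblockdiag\<close>\<close>

lemma block_eq_0_iff: "block M i j = 0 \<longleftrightarrow> (\<forall>a b. M $ (i, a) $ (j, b) = 0)"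
  by (simp add: block_def vec_eq_iff)

lemma block_diagonal_iff: "block_diagonal M \<longleftrightarrow> (\<forall>i j a b. i \<noteq> j \<longrightarrow> M $ (i, a) $ (j, b) = 0)"
  by (auto simp: block_diagonal_def block_eq_0_iff)

lemma symblockdiag_nth:
  "symblockdiag M $ (i, a) $ (j, b) = (if i = j then (M $ (i, a) $ (i, b) + M $ (i, b) $ (i, a)) / 2 else 0)"
  by (simp add: symblockdiag_def block_def transpose_def)

lemma linear_symblockdiag: "linear symblockdiag"
  by (rule linearI) (simp_all add: vec_eq_iff symblockdiag_nth add_divide_distrib algebra_simps)

lemma symblockdiag_syms: "symblockdiag M \<in> syms"
  by (simp add: mem_syms symblockdiag_nth)

lemma block_diagonal_symblockdiag: "block_diagonal (symblockdiag M)"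
  by (simp add: block_diagonal_iff symblockdiag_nth)

lemma symblockdiag_eq_0_iff: "M \<in> syms \<Longrightarrow> symblockdiag M = 0 \<longleftrightarrow> (\<forall>i. block M i i = 0)"
  unfolding block_eq_0_iff by (auto simp: vec_eq_iff symblockdiag_nth mem_syms)

text \<open>The supports do not meet. Hence along directions that fix the diagonal blocks, a
  gradient may be shifted by any block-diagonal matrix.\<close>

lemma block_diagonal_inner:
  assumes "block_diagonal L" "\<And>i. block M i i = 0"
  shows "L \<bullet> M = 0"
proof -
  have "L $ r $ s * M $ r $ s = 0" for r s
    using assms by (cases r; cases s) (metis block_diagonal_iff block_eq_0_iff mult_eq_0_iff)
  then show ?thesis unfolding inner_vec_def inner_real_def by (intro sum.neutral ballI) simp
qed

text \<open>A spanning set is counted: symmetrized products of unit vectors from one block, one for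
  each block and unordered pair of positions.\<close>

lemma dim_block_diagonal_syms:
  "dim {M :: real^('m::finite \<times> 'd::finite)^('m \<times> 'd). M \<in> syms \<and> block_diagonal M}
    \<le> CARD('m) * card (triangle CARD('d))"
proof -
  let ?D = "{M :: real^('m \<times> 'd)^('m \<times> 'd). M \<in> syms \<and> block_diagonal M}"
  \<comment> \<open>Numbering \<open>'d\<close> turns unordered pairs of positions into elements of
    \<open>triangle\<close>.\<close>
  obtain e :: "nat \<Rightarrow> 'd" where e: "bij_betw e {0..<CARD('d)} UNIV"
    using ex_bij_betw_nat_finite[of "UNIV :: 'd set"] by auto
  define s :: "'m \<Rightarrow> 'd \<Rightarrow> 'd \<Rightarrow> real^('m \<times> 'd)^('m \<times> 'd)"
    where "s i a b = sym_outer (axis (i, a) 1) (axis (i, b) 1)" for i a b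
  define T where "T = (\<lambda>(i, k, l). s i (e k) (e l)) ` (UNIV \<times> triangle CARD('d))"
  have mem: "s i a b \<in> T" for i a b
  proof -
    obtain k l where kl: "k < CARD('d)" "l < CARD('d)" "a = e k" "b = e l"
      using bij_betw_imp_surj_on[OF e] by (metis UNIV_I atLeastLessThan_iff imageE)
    show ?thesis
    proof (cases "k \<le> l")
      case True
      then show ?thesis
        unfolding T_def using kl by (intro image_eqI[of _ _ "(i, k, l)"]) (auto simp: triangle_def)
    next
      case False
      then show ?thesis
        unfolding T_def using kl
        by (intro image_eqI[of _ _ "(i, l, k)"]) (auto simp: triangle_def s_def sym_outer_commute)
    qed
  qed
  have "M \<in> span T" if M: "M \<in> ?D" for M
  proof -
    \<comment> \<open>Summing over all ordered pairs of rows gives half of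
      \<open>M + transpose M\<close>, which is \<open>M\<close> by symmetry.\<close>
    have "M = (\<Sum>r\<in>UNIV. \<Sum>q\<in>UNIV. (M $ r $ q / 2) *\<^sub>R sym_outer (axis r 1) (axis q 1))"
    proof -
      have entry: "sym_outer (axis r 1) (axis q 1) $ u $ v
          = (if q = v then if r = u then 1 else 0 else 0) + (if q = u then if r = v then 1 else 0 else 0)"
        for r q u v :: "'m \<times> 'd"
        by (simp add: sym_outer_def outer_def axis_def)
      have "(\<Sum>r\<in>UNIV. \<Sum>q\<in>UNIV. (M $ r $ q / 2) *\<^sub>R sym_outer (axis r 1) (axis q 1)) $ u $ v
          = (M $ u $ v + M $ v $ u) / 2" for u v
        by (simp add: entry distrib_left sum.distrib if_distrib[of "\<lambda>x. _ * x"] cong: if_cong)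
      moreover have "(M $ u $ v + M $ v $ u) / 2 = M $ u $ v" for u v
      proof -
        have "M $ v $ u = M $ u $ v" using M unfolding mem_syms by blast
        then show ?thesis by simp
      qed
      ultimately show ?thesis by (intro vec_eq_iff[THEN iffD2] allI) simp
    qed
    also have "\<dots> \<in> span T"
    proof (intro span_sum)
      fix r q :: "'m \<times> 'd"
      show "(M $ r $ q / 2) *\<^sub>R sym_outer (axis r 1) (axis q 1) \<in> span T"
      proof (cases "fst r = fst q")
        case True
        then have "sym_outer (axis r 1) (axis q 1) \<in> T"
          using mem by (metis prod.collapse s_def)
        then show ?thesis by (intro span_scale span_base)
      next
        case False
        then have "M $ r $ q = 0" using M by (cases r; cases q) (auto simp: block_diagonal_iff)
        then show ?thesis by (simp add: span_zero)
      qed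
    qed
    finally show ?thesis .
  qed
  moreover have "finite T" by (simp add: T_def)
  ultimately have "dim ?D \<le> card T" by (intro dim_le_card) auto
  also have "\<dots> \<le> card ((UNIV :: 'm set) \<times> triangle CARD('d))"
    unfolding T_def by (rule card_image_le) simp
  finally show ?thesis by (simp add: card_cartesian_product)
qed

text \<open>With \<open>r = rank Y\<close>, the images \<open>Y ** A ** transpose Y\<close> contain
  a space of dimension \<open>r * (r + 1) / 2\<close>, too large for \<open>symblockdiag\<close> to
  embed into the symmetric block-diagonal matrices; a nonzero kernel element is the direction
  sought.\<close>

lemma exists_face_direction:
  fixes Y :: "real^'p^('m::finite \<times> 'd::finite)"
  assumes rank: "CARD('m) * CARD('d) * (CARD('d) + 1) < rank Y * (rank Y + 1)"
  obtains A where "A \<in> syms" "Y ** A ** transpose Y \<noteq> 0"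
    "\<And>i. block (Y ** A ** transpose Y) i i = 0"
proof -
  \<comment> \<open>An orthonormal basis of the range of \<open>Y\<close> has \<open>rank Y\<close>
    elements and supplies the orthogonal family \<open>E\<close>.\<close>
  have "subspace (range ((*v) Y))"
    by (intro linear_subspace_image subspace_UNIV) simp
  then obtain B where B: "B \<subseteq> range ((*v) Y)" "pairwise orthogonal B" "\<And>x. x \<in> B \<Longrightarrow> norm x = 1"
    "independent B" "card B = rank Y"
    by (metis orthonormal_basis_subspace rank_dim_range)
  then obtain b where b: "bij_betw b {0..<rank Y} B"
    using ex_bij_betw_nat_finite[of B] independent_imp_finite by metis
  have bB: "b i \<in> B" if "i < rank Y" for i using b that by (auto simp: bij_betw_def)
  have orth: "b i \<bullet> b j = (if i = j then 1 else 0)" if "i < rank Y" "j < rank Y" for i j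
  proof (cases "i = j")
    case True
    then show ?thesis using B(3)[OF bB[OF that(1)]] by (simp add: dot_square_norm)
  next
    case False
    then have "b i \<noteq> b j" using b that by (auto simp: bij_betw_def inj_on_def)
    then show ?thesis using B(2) bB that False by (auto simp: pairwise_def orthogonal_def)
  qed
  define E where "E = (\<lambda>(i, j). sym_outer (b i) (b j)) ` triangle (rank Y)"
  \<comment> \<open>The count is made among the images, not among the \<open>A\<close>: for
    dependent columns of \<open>Y\<close> a nonzero \<open>A\<close> could have image 0.\<close>
  define W where "W = (\<lambda>A. Y ** A ** transpose Y) ` syms"
  have "linear (\<lambda>A. Y ** A ** transpose Y)"
    by (rule linearI)
       (simp_all add: matrix_add_ldistrib add_matrix_mult matrix_mult_scaleR scaleR_matrix_mult)
  then have W: "subspace W" unfolding W_def by (rule linear_subspace_image[OF _ subspace_syms])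
  have "E \<subseteq> W"
  proof -
    have "sym_outer (b i) (b j) \<in> W" if "i < rank Y" "j < rank Y" for i j
    proof -
      have "b i \<in> range ((*v) Y)" "b j \<in> range ((*v) Y)" using bB that B(1) by auto
      then obtain u v where "b i = Y *v u" "b j = Y *v v" by blast
      then show ?thesis
        unfolding W_def by (auto simp: congruence_sym_outer intro!: image_eqI[of _ _ "sym_outer u v"] sym_outer_syms)
    qed
    then show ?thesis by (auto simp: E_def triangle_def)
  qed
  then have EW: "span E \<subseteq> W" by (rule span_minimal[OF _ W])
  have "\<exists>M\<in>W. M \<noteq> 0 \<and> symblockdiag M = 0"
  proof (rule ccontr)
    assume "\<not> ?thesis"
    then have "inj_on symblockdiag (span E)"
      using EW linear_inj_on_iff_eq_0[OF linear_symblockdiag subspace_span] by blast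
    then have "dim (symblockdiag ` E) = dim E" by (rule dim_image_eq[OF linear_symblockdiag])
    also have "\<dots> = card (triangle (rank Y))"
      using independent_sym_outer[of "rank Y" b] orth dim_eq_card_independent unfolding E_def by metis
    finally have "card (triangle (rank Y)) = dim (symblockdiag ` E)" by simp
    also have "\<dots> \<le> dim {M :: real^('m \<times> 'd)^('m \<times> 'd). M \<in> syms \<and> block_diagonal M}"
      by (rule dim_subset) (auto simp: symblockdiag_syms block_diagonal_symblockdiag)
    also have "\<dots> \<le> CARD('m) * card (triangle CARD('d))" by (rule dim_block_diagonal_syms)
    finally have "2 * card (triangle (rank Y)) \<le> CARD('m) * (2 * card (triangle CARD('d)))" by simp
    then show False using rank by (simp only: card_triangle mult.assoc)
  qed
  then obtain A where "A \<in> syms" "Y ** A ** transpose Y \<noteq> 0" "symblockdiag (Y ** A ** transpose Y) = 0"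
    by (auto simp: W_def)
  then show thesis using that symblockdiag_eq_0_iff syms_congruence by blast
qed

text \<open>\<open>pstar m d\<close> is the nonnegative root of
  \<open>r * (r + 1) = m * d * (d + 1)\<close>; completing the square turns the comparison into one
  of natural numbers.\<close>

lemma rank_le_pstar_iff: "int r \<le> \<lfloor>pstar m d\<rfloor> \<longleftrightarrow> r * (r + 1) \<le> m * d * (d + 1)"
proof -
  have "int r \<le> \<lfloor>pstar m d\<rfloor> \<longleftrightarrow> 2 * real r + 1 \<le> sqrt (1 + 4 * real m * real d * (real d + 1))"
    by (simp add: le_floor_iff pstar_def field_simps)
  also have "2 * real r + 1 = sqrt ((2 * real r + 1)\<^sup>2)" by simp
  also have "\<dots> \<le> sqrt (1 + 4 * real m * real d * (real d + 1)) \<longleftrightarrow>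
      real (r * (r + 1)) \<le> real (m * d * (d + 1))"
  proof -
    have "(2 * real r + 1)\<^sup>2 = 1 + 4 * real (r * (r + 1))"
      by (simp add: power2_eq_square algebra_simps)
    moreover have "1 + 4 * real m * real d * (real d + 1) = 1 + 4 * real (m * d * (d + 1))"
      by (simp add: algebra_simps)
    ultimately show ?thesis by (simp only: real_sqrt_le_iff) linarith
  qed
  finally show ?thesis by (simp only: of_nat_le_iff)
qed

subsection \<open>Gradients and Hessians on the symmetric matrices\<close>

text \<open>\<open>grad\<close> is a definite description, so existence and uniqueness are both due.
  Existence: the vector representing the derivative is symmetrized, which leaves its pairing with
  symmetric matrices unchanged.\<close>

lemma grad_works:
  assumes "f differentiable_on syms" and X: "X \<in> syms"
  shows "grad f X \<in> syms" and "(f has_derivative (\<lambda>V. grad f X \<bullet> V)) (at X within syms)"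
proof -
  obtain D where D: "(f has_derivative D) (at X within syms)"
    using assms by (auto simp: differentiable_on_def differentiable_def)
  define H where "H = adjoint D 1"
  have DH: "D V = H \<bullet> V" for V
    using adjoint_works[OF has_derivative_linear[OF D], of V 1] by (simp add: H_def inner_commute)
  define G where "G = (1/2) *\<^sub>R (H + transpose H)"
  have G: "G \<in> syms" by (simp add: G_def mem_syms transpose_def)
  have DG: "D V = G \<bullet> V" if "V \<in> syms" for V
  proof -
    have "transpose H \<bullet> V = H \<bullet> V"
      using inner_transpose[of H V] that by (simp add: syms_def)
    then show ?thesis by (simp add: DH G_def inner_add_left)
  qed
  have GD: "(f has_derivative (\<lambda>V. G \<bullet> V)) (at X within syms)"
  proof -
    have lim: "((\<lambda>Z. (f Z - f X - D (Z - X)) /\<^sub>R norm (Z - X)) \<longlongrightarrow> 0) (at X within syms)"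
      using D by (simp add: has_derivative_at_within)
    \<comment> \<open>Only symmetric increments occur within \<open>syms\<close>, and on those
      \<open>D\<close> agrees with the pairing with \<open>G\<close>.\<close>
    have "\<forall>\<^sub>F Z in at X within syms. (f Z - f X - D (Z - X)) /\<^sub>R norm (Z - X)
        = (f Z - f X - G \<bullet> (Z - X)) /\<^sub>R norm (Z - X)"
      using X by (auto simp: eventually_at_filter DG subspace_diff[OF subspace_syms])
    from Lim_transform_eventually[OF lim this] show ?thesis
      by (simp add: has_derivative_at_within bounded_linear_inner_right)
  qed
  have "G' = G" if G': "G' \<in> syms" "(f has_derivative (\<lambda>V. G' \<bullet> V)) (at X within syms)" for G'
  proof -
    \<comment> \<open>The difference of two candidates is itself an admissible direction; testing
      both on it gives norm 0.\<close>
    have V: "G' - G \<in> syms" using G G' by (intro subspace_diff[OF subspace_syms])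
    have "G' \<bullet> (G' - G) = G \<bullet> (G' - G)"
      by (rule tendsto_unique[OF trivial_limit_at_right_real
            has_derivative_along_line[OF subspace_syms X V G'(2)]
            has_derivative_along_line[OF subspace_syms X V GD]])
    then have "(G' - G) \<bullet> (G' - G) = 0" by (simp add: inner_diff_left)
    then show ?thesis by simp
  qed
  then have "grad f X = G" unfolding grad_def using G GD by (intro the_equality conjI) (elim conjE | assumption)+
  then show "grad f X \<in> syms" "(f has_derivative (\<lambda>V. grad f X \<bullet> V)) (at X within syms)"
    using G GD by simp_all
qed

lemma hess_works:
  assumes "C2_on_syms f" and "X \<in> syms"
  shows "(grad f has_derivative hess f X) (at X within syms)"
proof -
  have "grad f differentiable (at X within syms)"
    using assms unfolding C2_on_syms_def differentiable_on_def by blast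
  then show ?thesis unfolding hess_def by (rule frechet_derivative_works[THEN iffD1])
qed

lemma convex_grad_inequality:
  assumes f: "f differentiable_on syms" "convex_on syms f" and X: "X \<in> syms" and Z: "Z \<in> syms"
  shows "f X + grad f X \<bullet> (Z - X) \<le> f Z"
proof -
  \<comment> \<open>The function \<open>- f\<close> is concave, which is the case of modulus
    0.\<close>
  have "- f Z + 0 / 2 * (norm (X - Z))\<^sup>2 \<le> - f X + - (grad f X \<bullet> (Z - X))"
  proof (rule strongly_concave_gradient_inequality[OF subspace_syms X Z])
    show "((\<lambda>V. - f V) has_derivative (\<lambda>V. - (grad f X \<bullet> V))) (at X within syms)"
      by (rule has_derivative_minus[OF grad_works(2)[OF f(1) X]])
    fix u v :: real
    assume "0 \<le> u" "0 \<le> v" "u + v = 1"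
    then have "f (u *\<^sub>R X + v *\<^sub>R Z) \<le> u * f X + v * f Z"
      using f(2) X Z by (simp add: convex_on_def)
    then show "u * - f X + v * - f Z + 0 / 2 * u * v * (norm (X - Z))\<^sup>2 \<le> - f (u *\<^sub>R X + v *\<^sub>R Z)"
      by simp
  qed
  then show ?thesis by simp
qed

lemma concave_grad_inequality:
  assumes f: "f differentiable_on syms" and X: "X \<in> syms" and Z: "Z \<in> syms"
    and conc: "\<And>u v. 0 \<le> u \<Longrightarrow> 0 \<le> v \<Longrightarrow> u + v = 1 \<Longrightarrow>
      f (u *\<^sub>R X + v *\<^sub>R Z) \<ge> u * f X + v * f Z + \<mu> / 2 * u * v * (norm (X - Z))\<^sup>2"
  shows "f Z + \<mu> / 2 * (norm (X - Z))\<^sup>2 \<le> f X + grad f X \<bullet> (Z - X)"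
  by (rule strongly_concave_gradient_inequality[OF subspace_syms X Z grad_works(2)[OF f X]]) (rule conc)

text \<open>A linear function is both convex and concave, so the two gradient inequalities
  meet.\<close>

lemma linear_grad_eq:
  assumes f: "f differentiable_on syms" "linear_on_syms f" and X: "X \<in> syms" and Z: "Z \<in> syms"
  shows "f Z = f X + grad f X \<bullet> (Z - X)"
proof -
  have lin: "f (u *\<^sub>R A + v *\<^sub>R B) = u * f A + v * f B" if "A \<in> syms" "B \<in> syms" for A B u v
  proof -
    have "u *\<^sub>R A \<in> syms" "v *\<^sub>R B \<in> syms" using that by (auto intro: subspace_scale[OF subspace_syms])
    then show ?thesis using f(2) that by (simp add: linear_on_syms_def)
  qed
  have "convex_on syms f"
    unfolding convex_on_def using lin subspace_imp_convex[OF subspace_syms] by auto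
  then have "f X + grad f X \<bullet> (Z - X) \<le> f Z" by (rule convex_grad_inequality[OF f(1) _ X Z])
  moreover have "f Z + 0 / 2 * (norm (X - Z))\<^sup>2 \<le> f X + grad f X \<bullet> (Z - X)"
    by (rule concave_grad_inequality[OF f(1) X Z]) (simp add: lin X Z)
  ultimately show ?thesis by simp
qed

text \<open>The difference quotients of \<open>grad f\<close> along \<open>B\<close>, paired with
  \<open>B\<close>, are at most minus the modulus times the squared norm of \<open>B\<close>; the
  bound passes to their limit, the Hessian form.\<close>

lemma strongly_concave_hess_neg:
  assumes f: "C2_on_syms f" "strongly_concave_on syms f" and X: "X \<in> syms" and B: "B \<in> syms" "B \<noteq> 0"
  shows "hess f X B \<bullet> B < 0"
proof -
  have diff: "f differentiable_on syms" using f(1) by (simp add: C2_on_syms_def)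
  obtain \<mu> where \<mu>: "\<mu> > 0" and raw: "\<forall>x\<in>syms. \<forall>y\<in>syms. \<forall>u\<ge>0. \<forall>v\<ge>0. u + v = 1 \<longrightarrow>
      f (u *\<^sub>R x + v *\<^sub>R y) \<ge> u * f x + v * f y + \<mu> / 2 * u * v * (norm (x - y))\<^sup>2"
    using f(2) unfolding strongly_concave_on_def by (elim conjE exE)
  have conc: "f (u *\<^sub>R x + v *\<^sub>R y) \<ge> u * f x + v * f y + \<mu> / 2 * u * v * (norm (x - y))\<^sup>2"
    if "x \<in> syms" "y \<in> syms" "0 \<le> u" "0 \<le> v" "u + v = 1" for x y u v
    using raw[rule_format, of x y u v] that by simp
  have mono: "(1 / t) *\<^sub>R (grad f (X + t *\<^sub>R B) - grad f X) \<bullet> B \<le> - \<mu> * (norm B)\<^sup>2" if t: "t \<in> {0<..<1}" for t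
  proof -
    have Z: "X + t *\<^sub>R B \<in> syms" using X B by (intro subspace_add subspace_scale subspace_syms)
    have "f (X + t *\<^sub>R B) + \<mu> / 2 * (norm (X - (X + t *\<^sub>R B)))\<^sup>2
        \<le> f X + grad f X \<bullet> (X + t *\<^sub>R B - X)"
      by (rule concave_grad_inequality[OF diff X Z]) (rule conc[OF X Z])
    moreover have "f X + \<mu> / 2 * (norm (X + t *\<^sub>R B - X))\<^sup>2
        \<le> f (X + t *\<^sub>R B) + grad f (X + t *\<^sub>R B) \<bullet> (X - (X + t *\<^sub>R B))"
      by (rule concave_grad_inequality[OF diff Z X]) (rule conc[OF Z X])
    \<comment> \<open>Adding the gradient inequalities at both endpoints cancels the values of
      \<open>f\<close> and joins the two halves of the modulus.\<close>
    ultimately have "\<mu> * (t * norm B)\<^sup>2 \<le> - t * ((grad f (X + t *\<^sub>R B) - grad f X) \<bullet> B)"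
      using t by (simp add: inner_diff_left right_diff_distrib)
    then have "t * ((grad f (X + t *\<^sub>R B) - grad f X) \<bullet> B) \<le> t * (t * (- \<mu> * (norm B)\<^sup>2))"
      by (simp add: power2_eq_square mult_ac)
    then have "(grad f (X + t *\<^sub>R B) - grad f X) \<bullet> B \<le> t * (- \<mu> * (norm B)\<^sup>2)"
      using t by (simp only: mult_le_cancel_left_pos greaterThanLessThan_iff)
    then show ?thesis using t by (simp add: pos_divide_le_eq mult.commute)
  qed
  have "((\<lambda>t. (1 / t) *\<^sub>R (grad f (X + t *\<^sub>R B) - grad f X) \<bullet> B) \<longlongrightarrow> hess f X B \<bullet> B) (at_right 0)"
    by (intro tendsto_intros has_derivative_along_line[OF subspace_syms X B(1) hess_works[OF f(1) X]])
  moreover have "\<forall>\<^sub>F t in at_right 0. (1 / t) *\<^sub>R (grad f (X + t *\<^sub>R B) - grad f X) \<bullet> B \<le> - \<mu> * (norm B)\<^sup>2"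
    using mono by (intro eventually_at_rightI[of 0 1]) auto
  ultimately have "hess f X B \<bullet> B \<le> - \<mu> * (norm B)\<^sup>2"
    by (intro tendsto_upperbound) auto
  also have "\<dots> < 0" using \<mu> B by simp
  finally show ?thesis .
qed

subsection \<open>Feasible set and critical points\<close>

lemma gram_psd: "psd (Y ** transpose Y)"
  using psd_congruence[OF mat_1_psd, of Y] by simp

lemma block_gram: "block (Y ** transpose Y) i i = slice Y i ** transpose (slice Y i)"
  by (simp add: block_def slice_def vec_eq_iff matrix_matrix_mult_def transpose_def)

lemma St_gram_feasible: "Y \<in> St \<Longrightarrow> Y ** transpose Y \<in> feasible"
  by (simp add: St_def feasible_def gram_psd block_gram)

lemma feasible_psd: "X \<in> feasible \<Longrightarrow> psd X"
  and feasible_syms: "X \<in> feasible \<Longrightarrow> X \<in> syms"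
  by (auto simp: feasible_def psd_def)

lemma block_diff: "block (A - B) i j = block A i j - block B i j"
  and block_add: "block (A + B) i j = block A i j + block B i j"
  and block_scaleR: "block (c *\<^sub>R A) i j = c *\<^sub>R block A i j"
  by (simp_all add: block_def vec_eq_iff)

lemma feasible_diff_block: "X \<in> feasible \<Longrightarrow> Z \<in> feasible \<Longrightarrow> block (Z - X) i i = 0"
  by (simp add: feasible_def block_diff)

lemma convex_feasible: "convex feasible"
proof (rule convexI)
  fix A B :: "real^('m::finite \<times> 'd::finite)^('m \<times> 'd)" and u v :: real
  assume "A \<in> feasible" "B \<in> feasible" "0 \<le> u" "0 \<le> v" "u + v = 1"
  then show "u *\<^sub>R A + v *\<^sub>R B \<in> feasible"
    by (simp add: feasible_def psd_add psd_scaleR block_add block_scaleR flip: scaleR_left_distrib)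
qed

text \<open>Faces whose relative interiors share a point are equal, so the face from
  \<open>minimal_face\<close> is the one described.\<close>

lemma face_at_eq:
  assumes "X \<in> feasible"
  shows "face_at X = {Z \<in> feasible. \<exists>t>0. X + t *\<^sub>R (X - Z) \<in> feasible}" (is "_ = ?F")
    and "face_at X face_of feasible"
proof -
  note F = minimal_face[OF convex_feasible assms]
  have uniq: "F' = ?F" if "F' face_of feasible" "X \<in> rel_interior F'" for F'
    using face_of_eq[OF that(1) F(1)] that(2) F(2) by blast
  show "face_at X = ?F"
    unfolding face_at_def by (rule the_equality) (use F uniq in blast)+
  then show "face_at X face_of feasible" using F(1) by simp
qed

lemma mem_face_at: "X \<in> feasible \<Longrightarrow> X \<in> face_at X"
  by (auto simp: face_at_eq intro!: exI[of _ 1])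

text \<open>A positive multiple of \<open>X\<close> is the sum of a feasible prolonged point and a
  positive multiple of \<open>Z\<close>, both positive semidefinite.\<close>

lemma face_at_kernel:
  assumes X: "X \<in> feasible" and Z: "Z \<in> face_at X" and x: "X *v x = 0"
  shows "Z *v x = 0"
proof -
  obtain t where t: "t > 0" and W: "X + t *\<^sub>R (X - Z) \<in> feasible" and Zf: "Z \<in> feasible"
    using Z by (auto simp: face_at_eq[OF X])
  have "(X + t *\<^sub>R (X - Z)) + t *\<^sub>R Z = (1 + t) *\<^sub>R X" by (simp add: algebra_simps)
  then have "((X + t *\<^sub>R (X - Z)) + t *\<^sub>R Z) *v x = 0" using x by (simp add: scaleR_matrix_vector)
  from psd_sum_kernel(2)[OF feasible_psd[OF W] psd_scaleR[OF feasible_psd[OF Zf]] this] t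
  show ?thesis by (simp add: scaleR_matrix_vector)
qed

text \<open>Feasible matrices have unit diagonal and hence constant trace, so adding a multiple of
  the identity to make \<open>G\<close> positive semidefinite shifts the pairing by a
  constant.\<close>

lemma inner_feasible_bounded_below:
  assumes G: "G \<in> syms"
  shows "bdd_below ((\<lambda>Z. G \<bullet> Z) ` (feasible :: (real^('m::finite \<times> 'd::finite)^('m \<times> 'd)) set))"
proof -
  obtain t where t: "psd (t *\<^sub>R mat 1 + G)" by (rule psd_mat_perturbation[OF G])
  have "- (t * CARD('m \<times> 'd)) \<le> G \<bullet> Z" if Z: "Z \<in> feasible" for Z :: "real^('m \<times> 'd)^('m \<times> 'd)"
  proof -
    have "Z $ r $ r = 1" for r
    proof -
      have "Z $ r $ r = block Z (fst r) (fst r) $ snd r $ snd r" by (simp add: block_def)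
      then show ?thesis using Z by (simp add: feasible_def mat_def)
    qed
    then have "mat 1 \<bullet> Z = real CARD('m \<times> 'd)"
      by (simp add: inner_vec_def mat_def if_distrib[of "\<lambda>x. x * _"] cong: if_cong)
    then show ?thesis using psd_inner_nonneg[OF t feasible_psd[OF Z]] by (simp add: inner_add_left)
  qed
  then show ?thesis by (intro bdd_belowI2)
qed

text \<open>The candidate for the dual matrix \<open>S\<close> in \<open>KKT_point\<close>, and the
  matrix that annihilates \<open>Y\<close> at a critical point.\<close>

definition slack :: "(real^('m::finite \<times> 'd::finite)^('m \<times> 'd) \<Rightarrow> real) \<Rightarrow> real^('m \<times> 'd)^('m \<times> 'd)
    \<Rightarrow> real^('m \<times> 'd)^('m \<times> 'd)" where
  "slack f X = grad f X - symblockdiag (grad f X ** X)"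

lemma slack_syms: "f differentiable_on syms \<Longrightarrow> X \<in> syms \<Longrightarrow> slack f X \<in> syms"
  by (simp add: slack_def subspace_diff subspace_syms grad_works symblockdiag_syms)

lemma critical_slack: "critical_point f Y \<Longrightarrow> slack f (Y ** transpose Y) ** Y = 0"
  by (simp add: critical_point_def slack_def Let_def)

lemma grad_inner_eq_slack_inner:
  assumes "\<And>i. block M i i = 0"
  shows "grad f X \<bullet> M = slack f X \<bullet> M"
  using block_diagonal_inner[OF block_diagonal_symblockdiag assms] by (simp add: slack_def inner_diff_left)

text \<open>Transposing \<open>S ** X = 0\<close> puts the columns of \<open>S\<close> in the kernel
  of \<open>X\<close>, hence of \<open>Z\<close>; the pairing is then the trace of a zero
  product.\<close>

lemma inner_eq_0_of_kernel:
  assumes S: "S \<in> syms" and X: "X \<in> syms" and SX: "S ** X = 0"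
    and ker: "\<And>x. X *v x = 0 \<Longrightarrow> Z *v x = 0"
  shows "S \<bullet> Z = 0"
proof -
  have "transpose (S ** X) = 0" by (simp add: SX)
  then have "X ** S = 0" using S X by (simp add: matrix_transpose_mul syms_def)
  then have "X *v (S *v x) = 0" for x by (simp add: matrix_vector_mul_assoc)
  then have "Z *v (S *v x) = 0" for x by (rule ker)
  then have ZS: "Z ** S = 0" by (simp add: matrix_eq flip: matrix_vector_mul_assoc)
  have "(mat 1 ** Z) \<bullet> S = mat 1 \<bullet> (S ** transpose Z)" by (rule inner_matrix_mult_right)
  also have "S ** transpose Z = transpose (Z ** S)" using S by (simp add: matrix_transpose_mul syms_def)
  finally show ?thesis by (simp add: ZS inner_commute)
qed

text \<open>\<open>Z - X\<close> has zero diagonal blocks, so the slack may replace the gradient,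
  and the slack is orthogonal to \<open>X\<close>.\<close>

lemma critical_grad_inner:
  assumes f: "f differentiable_on syms" and Y: "critical_point f Y" and X: "X = Y ** transpose Y"
    and Z: "Z \<in> feasible"
  shows "grad f X \<bullet> (Z - X) = slack f X \<bullet> Z"
proof -
  have Xf: "X \<in> feasible" using Y X by (simp add: critical_point_def St_gram_feasible)
  have SX: "slack f X ** X = 0"
    using critical_slack[OF Y] by (simp add: X matrix_mul_assoc)
  have "slack f X \<bullet> X = 0"
    using feasible_syms[OF Xf] by (intro inner_eq_0_of_kernel[OF slack_syms[OF f] _ SX]) auto
  then show ?thesis
    unfolding grad_inner_eq_slack_inner[OF feasible_diff_block[OF Xf Z]] by (simp add: inner_diff_right)
qed

text \<open>The common source of both face statements: constancy for linear \<open>f\<close> and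
  optimality for convex \<open>f\<close>.\<close>

lemma critical_face_stationary:
  assumes f: "f differentiable_on syms" and Y: "critical_point f Y" and X: "X = Y ** transpose Y"
    and Z: "Z \<in> face_at X"
  shows "grad f X \<bullet> (Z - X) = 0"
proof -
  have Xf: "X \<in> feasible" using Y X by (simp add: critical_point_def St_gram_feasible)
  have Zf: "Z \<in> feasible" using Z by (simp add: face_at_eq[OF Xf])
  have "slack f X ** X = 0"
    using critical_slack[OF Y] by (simp add: X matrix_mul_assoc)
  then have "slack f X \<bullet> Z = 0"
    using face_at_kernel[OF Xf Z] feasible_syms[OF Xf] slack_syms[OF f]
    by (intro inner_eq_0_of_kernel[of _ X]) auto
  then show ?thesis using critical_grad_inner[OF f Y X Zf] by simp
qed

text \<open>Splits the form into the curvature of \<open>f\<close> and a slack term. Each test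
  direction used later kills one of the two: \<open>outer v u\<close> the first,
  \<open>Y ** A\<close> the second.\<close>

lemma second_order_form:
  fixes Yd :: "real^'p^('m::finite \<times> 'd::finite)"
  assumes X: "X = Y ** transpose Y"
  shows "Yd \<bullet> (hess_g f Y Yd - symblockdiag (grad_g f Y ** transpose Y) ** Yd)
    = 2 * (Yd \<bullet> (hess f X (Yd ** transpose Y + Y ** transpose Yd) ** Y)) + 2 * (Yd \<bullet> (slack f X ** Yd))"
proof -
  have "grad_g f Y ** transpose Y = 2 *\<^sub>R (grad f X ** X)"
    by (simp add: grad_g_def X scaleR_matrix_mult matrix_mul_assoc)
  then have "symblockdiag (grad_g f Y ** transpose Y) = 2 *\<^sub>R symblockdiag (grad f X ** X)"
    by (simp add: linear_scale[OF linear_symblockdiag])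
  then show ?thesis
    by (simp add: hess_g_def slack_def scaleR_matrix_mult diff_matrix_mult inner_diff_right inner_add_right
        flip: X)
qed

lemma mem_tangent:
  "Yd \<in> tangent Y \<longleftrightarrow> (\<forall>i. block (Yd ** transpose Y + Y ** transpose Yd) i i = 0)"
proof -
  have "Yd ** transpose Y + Y ** transpose Yd \<in> syms"
    by (simp add: syms_def transpose_add matrix_transpose_mul add.commute)
  then show ?thesis by (simp add: tangent_def symblockdiag_eq_0_iff)
qed

text \<open>With \<open>Y *v u = 0\<close>, every \<open>outer v u\<close> is a tangent direction that leaves \<open>Y ** transpose Y\<close>
  unchanged to first order, so the Hessian reduces to the quadratic form of the slack matrix.\<close>

lemma rank_deficient_slack_psd:
  fixes Y :: "real^'p^('m::finite \<times> 'd::finite)"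
  assumes f: "C2_on_syms f" and Y: "second_order_critical_point f Y" and rank: "rank Y \<noteq> CARD('p)"
  shows "psd (slack f (Y ** transpose Y))"
proof -
  define X where "X = Y ** transpose Y"
  have X: "X \<in> syms" using gram_psd[of Y] by (simp add: X_def psd_syms)
  have S: "slack f X \<in> syms" using f X by (intro slack_syms) (simp_all add: C2_on_syms_def)
  obtain u where u: "u \<noteq> 0" "Y *v u = 0"
    using rank matrix_nonfull_linear_equations_eq[of Y] by blast
  have "0 \<le> v \<bullet> (slack f X *v v)" for v
  proof -
    have "outer v u ** transpose Y = 0" by (simp add: outer_mult_transpose u)
    moreover have "Y ** transpose (outer v u) = 0"
      by (simp add: transpose_outer matrix_mult_outer u)
    ultimately have Xd: "outer v u ** transpose Y + Y ** transpose (outer v u) = 0" by simp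
    then have "outer v u \<in> tangent Y" by (simp add: mem_tangent block_eq_0_iff)
    then have "0 \<le> outer v u \<bullet> (hess_g f Y (outer v u) - symblockdiag (grad_g f Y ** transpose Y) ** outer v u)"
      using Y by (simp add: second_order_critical_point_def)
    also have "\<dots> = 2 * (outer v u \<bullet> (slack f X ** outer v u))"
      unfolding second_order_form[OF X_def] Xd
      using linear_0[OF has_derivative_linear[OF hess_works[OF f X]]] by simp
    also have "\<dots> = 2 * ((v \<bullet> (slack f X *v v)) * (u \<bullet> u))"
      by (simp add: matrix_mult_outer inner_outer_outer)
    finally have "0 \<le> 2 * ((v \<bullet> (slack f X *v v)) * (u \<bullet> u))" .
    moreover have "0 < u \<bullet> u" using u by simp
    ultimately show ?thesis using mult_neg_pos[of "v \<bullet> (slack f X *v v)" "u \<bullet> u"] by linarith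
  qed
  then show ?thesis using S by (simp add: psd_def X_def)
qed

text \<open>With \<open>A\<close> from the dimension count, the identity plus or minus
  \<open>A / t\<close> is positive semidefinite for suitable \<open>t\<close>; congruence by
  \<open>Y\<close> gives \<open>X + B\<close> and \<open>X - B\<close> with unchanged diagonal
  blocks.\<close>

lemma high_rank_face_nontrivial:
  fixes Y :: "real^'p^('m::finite \<times> 'd::finite)"
  assumes Y: "Y \<in> St" and X: "X = Y ** transpose Y"
    and rank: "int (rank Y) > \<lfloor>pstar CARD('m) CARD('d)\<rfloor>"
  obtains B where "B \<noteq> 0" "X + B \<in> feasible" "X - B \<in> feasible"
proof -
  have "CARD('m) * CARD('d) * (CARD('d) + 1) < rank Y * (rank Y + 1)"
    using rank rank_le_pstar_iff[of "rank Y" "CARD('m)" "CARD('d)"] by linarith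
  then obtain A where A: "A \<in> syms" "Y ** A ** transpose Y \<noteq> 0"
    and 0: "\<And>i. block (Y ** A ** transpose Y) i i = 0"
    using exists_face_direction[of Y] by blast
  obtain t where t: "0 < t" "psd (t *\<^sub>R mat 1 + A)" "psd (t *\<^sub>R mat 1 - A)"
    by (rule psd_mat_perturbation[OF A(1)])
  define B where "B = (1 / t) *\<^sub>R (Y ** A ** transpose Y)"
  have "X + B = (1 / t) *\<^sub>R (Y ** (t *\<^sub>R mat 1 + A) ** transpose Y)"
    "X - B = (1 / t) *\<^sub>R (Y ** (t *\<^sub>R mat 1 - A) ** transpose Y)"
    using t(1)
    by (simp_all add: X B_def matrix_add_ldistrib add_matrix_mult matrix_mult_diff diff_matrix_mult
        matrix_mult_scaleR scaleR_matrix_mult scaleR_right_distrib scaleR_diff_right)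
  then have "psd (X + B)" "psd (X - B)"
    using t by (simp_all add: psd_scaleR psd_congruence)
  moreover have "block (X + B) i i = mat 1" "block (X - B) i i = mat 1" for i
    using St_gram_feasible[OF Y] 0 by (simp_all add: feasible_def X B_def block_add block_diff block_scaleR)
  moreover have "B \<noteq> 0" using A(2) t(1) by (simp add: B_def)
  ultimately show thesis using that by (simp add: feasible_def)
qed

lemma high_rank_face_pos_dim:
  fixes Y :: "real^'p^('m::finite \<times> 'd::finite)"
  assumes Y: "Y \<in> St" and X: "X = Y ** transpose Y"
    and rank: "int (rank Y) > \<lfloor>pstar CARD('m) CARD('d)\<rfloor>"
  shows "aff_dim (face_at X) > 0"
proof -
  have Xf: "X \<in> feasible" using Y X St_gram_feasible by simp
  obtain B where B: "B \<noteq> 0" "X + B \<in> feasible" "X - B \<in> feasible"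
    by (rule high_rank_face_nontrivial[OF Y X rank])
  have "X + B \<in> face_at X" using B by (auto simp: face_at_eq[OF Xf] intro!: exI[of _ 1])
  moreover have "X \<in> face_at X" by (rule mem_face_at[OF Xf])
  moreover have "X + B \<noteq> X" using B(1) by simp
  \<comment> \<open>\<open>aff_dim\<close> is -1 exactly on the empty set and 0 exactly on
    singletons; two distinct points exclude both.\<close>
  ultimately have "face_at X \<noteq> {}" "\<nexists>a. face_at X = {a}" by (metis empty_iff, metis singletonD)
  then have "aff_dim (face_at X) \<noteq> - 1" "aff_dim (face_at X) \<noteq> 0"
    using aff_dim_eq_0[of "face_at X"] aff_dim_empty[of "face_at X"] by auto
  then show ?thesis using aff_dim_geq[of "face_at X"] by linarith
qed

text \<open>Above the bound, \<open>X\<close> would be the midpoint of the nondegenerate segment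
  from \<open>X - B\<close> to \<open>X + B\<close>.\<close>

lemma extreme_point_low_rank:
  fixes Y :: "real^'p^('m::finite \<times> 'd::finite)"
  assumes Y: "Y \<in> St" and ext: "(Y ** transpose Y) extreme_point_of feasible"
  shows "int (rank Y) \<le> \<lfloor>pstar CARD('m) CARD('d)\<rfloor>"
proof (rule ccontr)
  assume "\<not> ?thesis"
  then have rank: "int (rank Y) > \<lfloor>pstar CARD('m) CARD('d)\<rfloor>" by simp
  define X where "X = Y ** transpose Y"
  obtain B where B: "B \<noteq> 0" "X + B \<in> feasible" "X - B \<in> feasible"
    by (rule high_rank_face_nontrivial[OF Y X_def rank])
  have "X - B \<noteq> X + B"
  proof
    assume "X - B = X + B"
    then have "2 *\<^sub>R B = 0" by (simp add: scaleR_2 algebra_simps)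
    then show False using B(1) by simp
  qed
  moreover have "X = (1 - 1/2) *\<^sub>R (X - B) + (1/2) *\<^sub>R (X + B)"
    by (simp add: scaleR_right_distrib scaleR_diff_right flip: scaleR_left_distrib)
  ultimately have "X \<in> open_segment (X - B) (X + B)"
    unfolding in_segment by (intro conjI exI[of _ "1/2"]) auto
  then show False using ext B by (auto simp: extreme_point_of_def X_def)
qed

lemma strongly_concave_second_order_extreme:
  fixes Y :: "real^'p^('m::finite \<times> 'd::finite)"
  assumes f: "C2_on_syms f" "strongly_concave_on syms f" and Y: "second_order_critical_point f Y"
  shows "(Y ** transpose Y) extreme_point_of feasible"
proof -
  define X where "X = Y ** transpose Y"
  have crit: "critical_point f Y" and St: "Y \<in> St"
    using Y by (auto simp: second_order_critical_point_def critical_point_def)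
  have Xf: "X \<in> feasible" using St by (simp add: X_def St_gram_feasible)
  have Xs: "X \<in> syms" by (rule feasible_syms[OF Xf])
  have False if ab: "a \<in> feasible" "b \<in> feasible" and seg: "X \<in> open_segment a b" for a b
  proof -
    obtain u where u: "0 < u" "u < 1" and Xab: "X = (1 - u) *\<^sub>R a + u *\<^sub>R b" and ne: "a \<noteq> b"
      using seg by (auto simp: in_segment)
    define B where "B = b - a"
    have B: "B \<in> syms" "B \<noteq> 0"
      using ab ne by (simp_all add: B_def subspace_diff subspace_syms feasible_syms)
    \<comment> \<open>\<open>X\<close> is a combination of \<open>a\<close> and \<open>b\<close>
      with positive weights, so its kernel lies in both of theirs.\<close>
    have ker: "B *v x = 0" if "(Y ** transpose Y) *v x = 0" for x
    proof -
      have "((1 - u) *\<^sub>R a + u *\<^sub>R b) *v x = 0" using that Xab by (simp add: X_def)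
      then have "((1 - u) *\<^sub>R a) *v x = 0" "(u *\<^sub>R b) *v x = 0"
        using psd_sum_kernel[OF psd_scaleR[OF feasible_psd[OF ab(1)], of "1 - u"]
            psd_scaleR[OF feasible_psd[OF ab(2)], of u]] u by auto
      then show ?thesis using u
        by (simp add: B_def scaleR_matrix_vector matrix_vector_mult_diff_rdistrib)
    qed
    obtain A where A: "A \<in> syms" "B = Y ** A ** transpose Y"
      by (rule kernel_imp_congruence[OF B(1) ker])
    define Yd where "Yd = Y ** A"
    have Xd: "Yd ** transpose Y + Y ** transpose Yd = 2 *\<^sub>R B"
      using A by (simp add: Yd_def matrix_transpose_mul syms_def matrix_mul_assoc scaleR_2)
    have "block B i i = 0" for i unfolding B_def by (rule feasible_diff_block[OF ab])
    then have "Yd \<in> tangent Y" by (simp add: mem_tangent Xd block_scaleR)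
    then have "0 \<le> Yd \<bullet> (hess_g f Y Yd - symblockdiag (grad_g f Y ** transpose Y) ** Yd)"
      using Y by (simp add: second_order_critical_point_def)
    also have "\<dots> = 2 * (Yd \<bullet> (hess f X (2 *\<^sub>R B) ** Y)) + 2 * (Yd \<bullet> (slack f X ** Yd))"
      unfolding second_order_form[OF X_def] Xd ..
    also have "slack f X ** Yd = 0"
      using critical_slack[OF crit] by (simp add: Yd_def X_def matrix_mul_assoc)
    also have "hess f X (2 *\<^sub>R B) = 2 *\<^sub>R hess f X B"
      by (rule linear_scale[OF has_derivative_linear[OF hess_works[OF f(1) Xs]]])
    \<comment> \<open>Moving \<open>Y\<close> across the inner product turns \<open>Yd\<close> into
      \<open>Yd ** transpose Y\<close>, which is \<open>B\<close>.\<close>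
    also have "Yd \<bullet> ((2 *\<^sub>R hess f X B) ** Y) = 2 * (hess f X B \<bullet> B)"
      using inner_matrix_mult_right[of Yd "transpose Y" "hess f X B"]
      by (simp add: scaleR_matrix_mult Yd_def A(2) inner_commute)
    finally show False using strongly_concave_hess_neg[OF f Xs B] by simp
  qed
  then show ?thesis using Xf unfolding extreme_point_of_def X_def by blast
qed

section \<open>Consequences for linear, concave and convex costs\<close>

lemma linear_constant_on_face:
  assumes f: "f differentiable_on syms" "linear_on_syms f" and Y: "critical_point f Y"
    and X: "X = Y ** transpose Y" and Z: "Z \<in> face_at X"
  shows "f Z = f X"
proof -
  have Xf: "X \<in> feasible" using Y X by (simp add: critical_point_def St_gram_feasible)
  have "Z \<in> feasible" using Z by (simp add: face_at_eq[OF Xf])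
  then show ?thesis
    using linear_grad_eq[OF f feasible_syms[OF Xf] feasible_syms] critical_face_stationary[OF f(1) Y X Z]
    by simp
qed

text \<open>Weak duality: \<open>f Z - f X\<close> is the pairing of the slack with
  \<open>Z\<close>, both positive semidefinite.\<close>

lemma linear_psd_slack_optimal:
  assumes f: "f differentiable_on syms" "linear_on_syms f" and Y: "critical_point f Y"
    and X: "X = Y ** transpose Y" and S: "psd (slack f X)"
  shows "is_arg_min f (\<lambda>Z. Z \<in> feasible) X"
proof -
  have Xf: "X \<in> feasible" using Y X by (simp add: critical_point_def St_gram_feasible)
  have "f X \<le> f Z" if Z: "Z \<in> feasible" for Z
    using linear_grad_eq[OF f feasible_syms[OF Xf] feasible_syms[OF Z]] critical_grad_inner[OF f(1) Y X Z]
      psd_inner_nonneg[OF S feasible_psd[OF Z]] by simp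
  then show ?thesis using Xf by (force simp: is_arg_min_def)
qed

text \<open>Makes the \<open>INF\<close> in the theorem a genuine infimum.\<close>

lemma linear_bdd_below:
  assumes f: "f differentiable_on syms" "linear_on_syms f"
  shows "bdd_below (f ` feasible)"
proof -
  have 0: "0 \<in> syms" by (rule subspace_0[OF subspace_syms])
  obtain c where c: "\<And>Z. Z \<in> feasible \<Longrightarrow> c \<le> grad f 0 \<bullet> Z"
    using inner_feasible_bounded_below[OF grad_works(1)[OF f(1) 0]] by (auto simp: bdd_below_def)
  have "f 0 + c \<le> f Z" if Z: "Z \<in> feasible" for Z
    using linear_grad_eq[OF f 0 feasible_syms[OF Z]] c[OF Z] by simp
  then show ?thesis by (rule bdd_belowI2)
qed

lemma psd_slack_KKT:
  assumes f: "f differentiable_on syms" and Y: "critical_point f Y"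
    and X: "X = Y ** transpose Y" and S: "psd (slack f X)"
  shows "KKT_point f X"
proof -
  have Xf: "X \<in> feasible" using Y X by (simp add: critical_point_def St_gram_feasible)
  \<comment> \<open>The multiplier is explicit: the block-diagonal correction already contained in
    \<open>slack\<close>.\<close>
  let ?L = "- symblockdiag (grad f X ** X)"
  have "?L \<in> syms" "block_diagonal ?L"
    using symblockdiag_syms[of "grad f X ** X"] block_diagonal_symblockdiag[of "grad f X ** X"]
    by (simp_all add: mem_syms block_diagonal_iff)
  moreover have "slack f X ** X = 0" using critical_slack[OF Y] by (simp add: X matrix_mul_assoc)
  moreover have "slack f X = grad f X + ?L" by (simp add: slack_def)
  ultimately show ?thesis using Xf S psd_syms[OF S] unfolding KKT_point_def by blast
qed

lemma convex_critical_face_optimal: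
  assumes f: "f differentiable_on syms" "convex_on syms f" and Y: "critical_point f Y"
    and X: "X = Y ** transpose Y"
  shows "is_arg_min f (\<lambda>Z. Z \<in> face_at X) X"
proof -
  have Xf: "X \<in> feasible" using Y X by (simp add: critical_point_def St_gram_feasible)
  have "f X \<le> f Z" if Z: "Z \<in> face_at X" for Z
  proof -
    have Zf: "Z \<in> feasible" using Z by (simp add: face_at_eq[OF Xf])
    show ?thesis
      using convex_grad_inequality[OF f feasible_syms[OF Xf] feasible_syms[OF Zf]] critical_face_stationary[OF f(1) Y X Z]
      by simp
  qed
  then show ?thesis using mem_face_at[OF Xf] by (force simp: is_arg_min_def)
qed

lemma strictly_convex_imp_convex_on:
  assumes "strictly_convex_on S f"
  shows "convex_on S f"
proof (rule convex_onI)
  show "convex S" using assms by (simp add: strictly_convex_on_def)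
  fix t :: real and x y
  assume "0 < t" "t < 1" "x \<in> S" "y \<in> S"
  then show "f ((1 - t) *\<^sub>R x + t *\<^sub>R y) \<le> (1 - t) * f x + t * f y"
  proof (cases "x = y")
    case True
    then show ?thesis by (simp flip: scaleR_left_distrib distrib_right)
  next
    case False
    have "\<forall>x\<in>S. \<forall>y\<in>S. \<forall>u>0. \<forall>v>0. x \<noteq> y \<longrightarrow> u + v = 1 \<longrightarrow>
        f (u *\<^sub>R x + v *\<^sub>R y) < u * f x + v * f y"
      using assms by (simp add: strictly_convex_on_def)
    from this[rule_format, of x y "1 - t" t] False show ?thesis
      using \<open>0 < t\<close> \<open>t < 1\<close> \<open>x \<in> S\<close> \<open>y \<in> S\<close> by simp
  qed
qed

text \<open>The midpoint of two distinct minimizers would have a smaller value.\<close>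

lemma strictly_convex_unique_arg_min:
  assumes f: "strictly_convex_on S f" and F: "F \<subseteq> S" "convex F"
    and x: "is_arg_min f (\<lambda>z. z \<in> F) x"
  shows "{z. is_arg_min f (\<lambda>w. w \<in> F) z} = {x}"
proof -
  have "z = x" if z: "is_arg_min f (\<lambda>w. w \<in> F) z" for z
  proof (rule ccontr)
    assume "z \<noteq> x"
    have zx: "z \<in> F" "x \<in> F" "f z = f x" using x z by (auto simp: is_arg_min_def not_less intro: antisym)
    have "f ((1/2) *\<^sub>R z + (1/2) *\<^sub>R x) < 1/2 * f z + 1/2 * f x"
    proof -
      have mid: "\<forall>x\<in>S. \<forall>y\<in>S. \<forall>u>0. \<forall>v>0. x \<noteq> y \<longrightarrow> u + v = 1 \<longrightarrow>
          f (u *\<^sub>R x + v *\<^sub>R y) < u * f x + v * f y"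
        using f by (simp add: strictly_convex_on_def)
      show ?thesis
        by (rule mid[rule_format]) (use zx F(1) \<open>z \<noteq> x\<close> in auto)
    qed
    also have "\<dots> = f x" using zx by simp
    finally have "f ((1/2) *\<^sub>R z + (1/2) *\<^sub>R x) < f x" .
    moreover have "(1/2) *\<^sub>R z + (1/2) *\<^sub>R x \<in> F" using zx by (intro convexD[OF F(2)]) auto
    ultimately show False using x by (auto simp: is_arg_min_def)
  qed
  then show ?thesis using x by blast
qed

theorem corollary3p12:
  fixes f :: "real^('m::finite \<times> 'd::finite)^('m \<times> 'd) \<Rightarrow> real"
    and Y :: "real^'p::finite^('m \<times> 'd)"
    and X :: "real^('m \<times> 'd)^('m \<times> 'd)"
  assumes "CARD('d) \<le> CARD('p)" and "CARD('p) \<le> CARD('m) * CARD('d)"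
    and "C2_on_syms f"
    and "Y \<in> St" and "X = Y ** transpose Y"
  shows
    "(linear_on_syms f \<and> critical_point f Y \<longrightarrow>
        f constant_on face_at X \<and>
        (second_order_critical_point f Y \<and> int CARD('p) > \<lfloor>pstar CARD('m) CARD('d)\<rfloor> \<longrightarrow>
           is_arg_min f (\<lambda>Z. Z \<in> feasible) X \<or>
           (rank Y = CARD('p) \<and> aff_dim (face_at X) > 0 \<and>
            (\<forall>Z \<in> face_at X. f Z > (INF W \<in> feasible. f W))))) \<and>
     (strongly_concave_on syms f \<longrightarrow>
        (second_order_critical_point f Y \<longrightarrow> X extreme_point_of feasible) \<and>
        (\<forall>Y' :: real^'p^('m \<times> 'd). second_order_critical_point f Y' \<longrightarrow>
           int (rank Y') \<le> \<lfloor>pstar CARD('m) CARD('d)\<rfloor>) \<and>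
        (second_order_critical_point f Y \<and> int CARD('p) > \<lfloor>pstar CARD('m) CARD('d)\<rfloor> \<longrightarrow>
           KKT_point f X)) \<and>
     (critical_point f Y \<longrightarrow>
        (convex_on syms f \<longrightarrow> is_arg_min f (\<lambda>Z. Z \<in> face_at X) X) \<and>
        (strictly_convex_on syms f \<longrightarrow> {Z. is_arg_min f (\<lambda>W. W \<in> face_at X) Z} = {X}))"
proof -
  note C2 = assms(3) and St = assms(4) and X = assms(5)
  have diff: "f differentiable_on syms" using C2 by (simp add: C2_on_syms_def)
  have Xf: "X \<in> feasible" using St X St_gram_feasible by simp
  have crit: "critical_point f Y'" if "second_order_critical_point f Y'" for Y' :: "real^'p^('m \<times> 'd)"
    using that by (simp add: second_order_critical_point_def)
  have low: "int (rank Y') \<le> \<lfloor>pstar CARD('m) CARD('d)\<rfloor>"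
    if "strongly_concave_on syms f" "second_order_critical_point f Y'" for Y' :: "real^'p^('m \<times> 'd)"
    using extreme_point_low_rank[OF _ strongly_concave_second_order_extreme[OF C2 that]] crit[OF that(2)]
    by (simp add: critical_point_def)
  have suboptimal: "rank Y = CARD('p) \<and> aff_dim (face_at X) > 0 \<and>
      (\<forall>Z \<in> face_at X. f Z > (INF W \<in> feasible. f W))"
    if lin: "linear_on_syms f" and so: "second_order_critical_point f Y"
      and p: "int CARD('p) > \<lfloor>pstar CARD('m) CARD('d)\<rfloor>"
      and nopt: "\<not> is_arg_min f (\<lambda>Z. Z \<in> feasible) X"
  proof (intro conjI ballI)
    \<comment> \<open>Rank deficiency would make the slack positive semidefinite and
      \<open>X\<close> globally optimal.\<close>
    show full: "rank Y = CARD('p)"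
      using nopt linear_psd_slack_optimal[OF diff lin crit[OF so] X] rank_deficient_slack_psd[OF C2 so] X
      by blast
    show "aff_dim (face_at X) > 0"
      by (rule high_rank_face_pos_dim[OF St X]) (simp add: full p)
    fix Z assume Z: "Z \<in> face_at X"
    obtain W where W: "W \<in> feasible" "f W < f X" using nopt Xf by (auto simp: is_arg_min_def)
    have "(INF W \<in> feasible. f W) \<le> f W" by (rule cINF_lower[OF linear_bdd_below[OF diff lin] W(1)])
    also have "\<dots> < f Z" using W linear_constant_on_face[OF diff lin crit[OF so] X Z] by simp
    finally show "f Z > (INF W \<in> feasible. f W)" .
  qed
  have const: "f constant_on face_at X" if "linear_on_syms f" "critical_point f Y"
    using linear_constant_on_face[OF diff that X] unfolding constant_on_def by blast
  have KKT: "KKT_point f X"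
    if "strongly_concave_on syms f" and so: "second_order_critical_point f Y"
      and "int CARD('p) > \<lfloor>pstar CARD('m) CARD('d)\<rfloor>"
  proof -
    \<comment> \<open>Extremality caps the rank at the floor of \<open>pstar\<close>, which is below
      \<open>CARD('p)\<close>; so \<open>Y\<close> is rank deficient.\<close>
    have "rank Y \<noteq> CARD('p)" using low[OF that(1,2)] that(3) by linarith
    from rank_deficient_slack_psd[OF C2 so this] show ?thesis
      by (intro psd_slack_KKT[OF diff crit[OF so] X]) (simp add: X)
  qed
  have strict: "{Z. is_arg_min f (\<lambda>W. W \<in> face_at X) Z} = {X}"
    if "critical_point f Y" "strictly_convex_on syms f"
  proof (rule strictly_convex_unique_arg_min[OF that(2)])
    show "face_at X \<subseteq> syms" using feasible_syms by (auto simp: face_at_eq[OF Xf])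
    show "convex (face_at X)" by (rule face_of_imp_convex[OF face_at_eq(2)[OF Xf]])
    show "is_arg_min f (\<lambda>Z. Z \<in> face_at X) X"
      by (rule convex_critical_face_optimal[OF diff strictly_convex_imp_convex_on[OF that(2)] that(1) X])
  qed
  have extreme: "X extreme_point_of feasible"
    if "strongly_concave_on syms f" "second_order_critical_point f Y"
    unfolding X by (rule strongly_concave_second_order_extreme[OF C2 that])
  have opt: "is_arg_min f (\<lambda>Z. Z \<in> face_at X) X" if "critical_point f Y" "convex_on syms f"
    by (rule convex_critical_face_optimal[OF diff that(2,1) X])
  show ?thesis
    by (intro conjI impI allI; (elim conjE)?)
       (use const suboptimal extreme low KKT opt strict in blast)+
qed

end
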